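(* Let $X,Y,c,y_0,Z,Q,b$ be as in the context. (i) If $c$ is twisted (for every $x\in X$ the map $y\mapsto D_xc(x,y)$ is injective on $\overline Y$), then $b$ is bi-twisted: for every $z\in Z$ the map $y\mapsto D_zb(z,y)$ is injective on $\overline Y$, and for every $y\in Y$ the map $z\mapsto D_yb(z,y)$ is injective on $Z$. (ii) If $c$ is non-degenerate ($D^2_{xy}c(x,y):T_yY\to T_x^*X$ is injective for all $x\in X$, $y\in Y$), then $b$ is non-degenerate ($D^2_{zy}b(z,y):T_yY\to T^*_zZ$ is injective for all $z\in Z$, $y\in Y$). (iii) If $Y$ is $c$-convex with respect to $X$ (for every $x\in X$, $D_xc(x,Y)=\{D_xc(x,y):y\in Y\}$ is a convex subset of $T_x^*X$), then $Y$ is $b$-convex with respect to $Z$ (for every $z\in Z$, $D_zb(z,Y)=\{D_zb(z,y):y\in Y\}$ is a convex subset of $T_z^*Z$).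
   Context: Let $m\ge n$, and let $X$ and $Y$ be smooth manifolds of dimensions $m$ and $n$, with $Y$ connected, smoothly embedded in larger manifolds in which their closures are compact. Let $c\in C^4(\overline X\times\overline Y)$ be such that the map $D^2_{xy}c(x,y):T_yY\to T^*_xX$, $\frac{\partial}{\partial y^i}\mapsto \frac{\partial^2c(x,y)}{\partial y^i\partial x^j}dx^j$, is injective for all $x\in X,y\in Y$. $D_xc$, $D_yc$ denote the differentials of $c$ in $x$ and $y$; the notation for $b$ is analogous. Assume that for every $x\in X$ the level set $L_x(y):=\{\overline x\in X: D_yc(\overline x,y)=D_yc(x,y)\}$ is connected and independent of $y\in Y$; write it $L_x$. Let $Z=X/\!\sim$, where $x\sim\overline x$ iff $\overline x\in L_x$, with quotient map $Q:X\to Z$. Fix $y_0\in Y$. The map $x\mapsto D_yc(x,y_0)$ has the same level sets as $Q$ and is open, so $Z$ is identified with the open subset $D_yc(X,y_0)\subseteq T^*_{y_0}Y$ (an $n$-dimensional manifold) and $Q$ with $x\mapsto D_yc(x,y_0)$. The function $b:Z\times Y\to\mathbb R$ is defined uniquely by $D_yb(z,y)=D_yc(x,y)$ for $x\in Q^{-1}(z)$, $y\in Y$, together with $b(z,y_0)=0$; $b$ and $D_zb$ are extended continuously to $y\in\overline Y$. *)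

theory Defs
  imports "HOL-Analysis.Analysis"
begin

section \<open>Functions of class C^k and smooth manifolds\<close>

text \<open>Intended for open sets in finite-dimensional spaces, where continuity of all iterated
  directional derivatives is the usual notion.\<close>

primrec Ck_on :: "nat \<Rightarrow> 'e::real_normed_vector set \<Rightarrow> ('e \<Rightarrow> 'w::real_normed_vector) \<Rightarrow> bool" where
  "Ck_on 0 S f \<longleftrightarrow> continuous_on S f"
| "Ck_on (Suc k) S f \<longleftrightarrow>
     (\<forall>x\<in>S. f differentiable (at x)) \<and> (\<forall>v. Ck_on k S (\<lambda>x. frechet_derivative f (at x) v))"

definition smooth_on :: "'e::real_normed_vector set \<Rightarrow> ('e \<Rightarrow> 'w::real_normed_vector) \<Rightarrow> bool" where
  "smooth_on S f \<longleftrightarrow> (\<forall>k. Ck_on k S f)"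

text \<open>A chart is a domain together with a coordinate map, an atlas is a set of charts.\<close>

type_synonym ('a, 'e) chart = "'a set \<times> ('a \<Rightarrow> 'e)"

definition transition :: "('a, 'e) chart \<Rightarrow> ('a, 'h) chart \<Rightarrow> 'e \<Rightarrow> 'h" where
  "transition \<kappa> \<mu> = snd \<mu> \<circ> inv_into (fst \<kappa>) (snd \<kappa>)"

definition overlap :: "('a, 'e) chart \<Rightarrow> ('a, 'h) chart \<Rightarrow> 'e set" where
  "overlap \<kappa> \<mu> = snd \<kappa> ` (fst \<kappa> \<inter> fst \<mu>)"

text \<open>A manifold without boundary whose underlying space is the subset \<open>S\<close> with its subspace
  topology; its dimension is \<open>DIM('e)\<close>. Hausdorffness and second countability are inherited from
  the type \<open>'a\<close>. The atlas need not be maximal.\<close>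

definition smooth_manifold ::
    "'a::{t2_space, second_countable_topology} set \<Rightarrow> ('a, 'e::euclidean_space) chart set \<Rightarrow> bool" where
  "smooth_manifold S A \<longleftrightarrow>
     (\<forall>(U, \<phi>)\<in>A. openin (top_of_set S) U \<and> open (\<phi> ` U) \<and>
                  homeomorphism U (\<phi> ` U) \<phi> (inv_into U \<phi>)) \<and>
     (\<Union>\<kappa>\<in>A. fst \<kappa>) = S \<and>
     (\<forall>\<kappa>\<in>A. \<forall>\<mu>\<in>A. smooth_on (overlap \<kappa> \<mu>) (transition \<kappa> \<mu>))"

text \<open>For manifolds \<open>(S, A)\<close> and \<open>(T, B)\<close> with \<open>S \<subseteq> T\<close>, both carrying the subspace topology, the
  inclusion is a topological embedding; it is a smooth embedding iff it is a smooth immersion.\<close>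

definition smoothly_embedded ::
    "'a set \<Rightarrow> ('a, 'e::euclidean_space) chart set \<Rightarrow> 'a set \<Rightarrow> ('a, 'h::euclidean_space) chart set \<Rightarrow> bool" where
  "smoothly_embedded S A T B \<longleftrightarrow> S \<subseteq> T \<and>
     (\<forall>\<kappa>\<in>A. \<forall>\<mu>\<in>B. smooth_on (overlap \<kappa> \<mu>) (transition \<kappa> \<mu>) \<and>
        (\<forall>u\<in>overlap \<kappa> \<mu>. inj (frechet_derivative (transition \<kappa> \<mu>) (at u))))"

text \<open>A function is \<open>C^k\<close> on \<open>S \<times> T\<close>, for arbitrary subsets \<open>S\<close> and \<open>T\<close> of manifolds with atlases
  \<open>A\<close> and \<open>B\<close>, if near every point of \<open>S \<times> T\<close> it is the restriction of a \<open>C^k\<close> function defined on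
  a neighbourhood in the product manifold.\<close>

definition Ck_on_product ::
    "nat \<Rightarrow> ('a, 'e::euclidean_space) chart set \<Rightarrow> 'a set \<Rightarrow> ('b, 'f::euclidean_space) chart set \<Rightarrow> 'b set
       \<Rightarrow> ('a \<Rightarrow> 'b \<Rightarrow> real) \<Rightarrow> bool" where
  "Ck_on_product k A S B T c \<longleftrightarrow>
     (\<forall>p\<in>S. \<forall>q\<in>T. \<exists>(U, \<phi>)\<in>A. \<exists>(V, \<psi>)\<in>B. p \<in> U \<and> q \<in> V \<and>
        (\<exists>W g. open W \<and> (\<phi> p, \<psi> q) \<in> W \<and> Ck_on k W g \<and>
           (\<forall>x\<in>S \<inter> U. \<forall>y\<in>T \<inter> V. (\<phi> x, \<psi> y) \<in> W \<longrightarrow> c x y = g (\<phi> x, \<psi> y))))"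

section \<open>Differentials\<close>

text \<open>The tangent space at \<open>x\<close> is identified with the model space \<open>'e\<close> by means of a preferred
  chart at \<open>x\<close>, so the cotangent space is the dual \<open>'e \<Rightarrow>\<^sub>L real\<close>. Changing the chart changes these
  identifications by a linear isomorphism.\<close>

definition chart_at :: "('a, 'e) chart set \<Rightarrow> 'a \<Rightarrow> ('a, 'e) chart" where
  "chart_at A x = (SOME \<kappa>. \<kappa> \<in> A \<and> x \<in> fst \<kappa>)"

definition has_differential ::
    "('a, 'e::real_normed_vector) chart set \<Rightarrow> ('a \<Rightarrow> 'w::real_normed_vector) \<Rightarrow> 'a \<Rightarrow> ('e \<Rightarrow>\<^sub>L 'w) \<Rightarrow> bool" where
  "has_differential A f x D \<longleftrightarrow>
     (case chart_at A x of (U, \<phi>) \<Rightarrow>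
        ((f \<circ> inv_into U \<phi>) has_derivative blinfun_apply D) (at (\<phi> x)))"

definition differential ::
    "('a, 'e::real_normed_vector) chart set \<Rightarrow> ('a \<Rightarrow> 'w::real_normed_vector) \<Rightarrow> 'a \<Rightarrow> 'e \<Rightarrow>\<^sub>L 'w" where
  "differential A f x = (THE D. has_differential A f x D)"

definition Dx ::
    "('a, 'e::real_normed_vector) chart set \<Rightarrow> ('a \<Rightarrow> 'b \<Rightarrow> real) \<Rightarrow> 'a \<Rightarrow> 'b \<Rightarrow> 'e \<Rightarrow>\<^sub>L real" where
  "Dx A c x y = differential A (\<lambda>x'. c x' y) x"

definition Dy ::
    "('b, 'f::real_normed_vector) chart set \<Rightarrow> ('a \<Rightarrow> 'b \<Rightarrow> real) \<Rightarrow> 'a \<Rightarrow> 'b \<Rightarrow> 'f \<Rightarrow>\<^sub>L real" where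
  "Dy B c x y = differential B (c x) y"

text \<open>For fixed \<open>x\<close>, the covector \<open>D\<^sub>x c(x,y)\<close> lies in the fixed vector space \<open>T\<^sup>*\<^sub>x X\<close>; the mixed
  second derivative is its differential in \<open>y\<close>.\<close>

definition Dxy ::
    "('a, 'e::real_normed_vector) chart set \<Rightarrow> ('b, 'f::real_normed_vector) chart set \<Rightarrow>
       ('a \<Rightarrow> 'b \<Rightarrow> real) \<Rightarrow> 'a \<Rightarrow> 'b \<Rightarrow> 'f \<Rightarrow>\<^sub>L ('e \<Rightarrow>\<^sub>L real)" where
  "Dxy A B c x y = differential B (\<lambda>y'. Dx A c x y') y"

section \<open>Conditions on the cost\<close>

definition nondegenerate ::
    "('a, 'e::real_normed_vector) chart set \<Rightarrow> 'a set \<Rightarrow> ('b, 'f::real_normed_vector) chart set \<Rightarrow> 'b set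
       \<Rightarrow> ('a \<Rightarrow> 'b \<Rightarrow> real) \<Rightarrow> bool" where
  "nondegenerate A X B Y c \<longleftrightarrow> (\<forall>x\<in>X. \<forall>y\<in>Y. inj (blinfun_apply (Dxy A B c x y)))"

definition cost_convex ::
    "('a, 'e::real_normed_vector) chart set \<Rightarrow> 'a set \<Rightarrow> 'b set \<Rightarrow> ('a \<Rightarrow> 'b \<Rightarrow> real) \<Rightarrow> bool" where
  "cost_convex A X Y c \<longleftrightarrow> (\<forall>x\<in>X. convex (Dx A c x ` Y))"

text \<open>The argument \<open>D\<close> is the differential in the first variable as a function on \<open>X \<times> closure Y\<close>.\<close>

definition twisted ::
    "'a set \<Rightarrow> 'b::topological_space set \<Rightarrow> ('a \<Rightarrow> 'b \<Rightarrow> 'e::real_normed_vector \<Rightarrow>\<^sub>L real) \<Rightarrow> bool" where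
  "twisted X Y D \<longleftrightarrow> (\<forall>x\<in>X. inj_on (D x) (closure Y))"

definition continuous_extension ::
    "'b::t2_space set \<Rightarrow> ('b \<Rightarrow> 'w::t2_space) \<Rightarrow> 'b \<Rightarrow> 'w" where
  "continuous_extension Y g y = (if y \<in> Y then g y else Lim (at y within Y) g)"

section \<open>Level sets and the quotient\<close>

definition level_set ::
    "'a set \<Rightarrow> ('b, 'f::real_normed_vector) chart set \<Rightarrow> ('a \<Rightarrow> 'b \<Rightarrow> real) \<Rightarrow> 'a \<Rightarrow> 'b \<Rightarrow> 'a set" where
  "level_set X B c x y = {x' \<in> X. Dy B c x' y = Dy B c x y}"

definition quotient_space ::
    "'a set \<Rightarrow> ('b, 'f::real_normed_vector) chart set \<Rightarrow> ('a \<Rightarrow> 'b \<Rightarrow> real) \<Rightarrow> 'b \<Rightarrow> 'a set set" where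
  "quotient_space X B c y\<^sub>0 = X // {(x, x'). x \<in> X \<and> x' \<in> level_set X B c x y\<^sub>0}"

text \<open>\<open>x \<mapsto> D\<^sub>y c(x,y\<^sub>0)\<close> is constant on each equivalence class and descends to a bijection of the
  quotient onto \<open>D\<^sub>y c(X,y\<^sub>0) \<subseteq> T\<^sup>*\<^sub>y\<^sub>0 Y\<close>; this bijection is taken as a global chart.\<close>

definition quotient_atlas ::
    "'a set \<Rightarrow> ('b, 'f::real_normed_vector) chart set \<Rightarrow> ('a \<Rightarrow> 'b \<Rightarrow> real) \<Rightarrow> 'b
       \<Rightarrow> ('a set, 'f \<Rightarrow>\<^sub>L real) chart set" where
  "quotient_atlas X B c y\<^sub>0 =
     {(quotient_space X B c y\<^sub>0, \<lambda>z. the_elem ((\<lambda>x. Dy B c x y\<^sub>0) ` z))}"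

text \<open>The reduced cost. The quotient map sends \<open>x\<close> to its class, so \<open>Q\<^sup>-\<^sup>1(z)\<close> is \<open>z\<close> itself. The
  first conjunct contains the differentiability of \<open>b z\<close> at \<open>y\<close>; the last one is the continuous
  extension of \<open>b\<close> to the closure of \<open>Y\<close>. Regularity of \<open>b\<close> in \<open>z\<close> is not assumed.\<close>

definition is_reduced_cost ::
    "'a set set \<Rightarrow> ('b::t2_space, 'f::real_normed_vector) chart set \<Rightarrow> 'b set \<Rightarrow> ('a \<Rightarrow> 'b \<Rightarrow> real) \<Rightarrow> 'b
       \<Rightarrow> ('a set \<Rightarrow> 'b \<Rightarrow> real) \<Rightarrow> bool" where
  "is_reduced_cost Z B Y c y\<^sub>0 b \<longleftrightarrow>
     (\<forall>z\<in>Z. \<forall>x\<in>z. \<forall>y\<in>Y. has_differential B (b z) y (Dy B c x y)) \<and>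
     (\<forall>z\<in>Z. b z y\<^sub>0 = 0) \<and>
     (\<forall>z\<in>Z. continuous_on (closure Y) (b z))"

end

theory Submission
  imports Defs
begin

text \<open>
  Since \<open>Y\<close> is connected, \<open>b(Q(x),y) = c(x,y) - c(x,y\<^sub>0)\<close>. In the global chart of \<open>Z\<close> the quotient
  map is \<open>F(x) = D\<^sub>yc(x,y\<^sub>0)\<close>. By the symmetry of second derivatives \<open>T = DF(x)\<close> is the transpose of
  the injective map \<open>D\<^sup>2\<^sub>x\<^sub>yc(x,y\<^sub>0)\<close>, so it is onto and has a right inverse \<open>R\<close>. A function whose
  composition with a submersion is differentiable is itself differentiable, hence
  \<open>D\<^sub>zb(z,y) = (D\<^sub>xc(x,y) - D\<^sub>xc(x,y\<^sub>0)) R\<close> and \<open>D\<^sub>xc(x,y) = D\<^sub>xc(x,y\<^sub>0) + D\<^sub>zb(z,y) T\<close> whenever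
  \<open>z = Q(x)\<close>. For fixed \<open>x\<close>, the covectors \<open>D\<^sub>zb(z,y)\<close> and \<open>D\<^sub>xc(x,y)\<close> thus determine each other
  by affine maps independent of \<open>y\<close>, which transfers injectivity in \<open>y\<close> (by continuity also on the
  closure of \<open>Y\<close>), non-degeneracy and convexity from \<open>c\<close> to \<open>b\<close>.
\<close>

section \<open>Second derivatives and submersions\<close>

text \<open>Two applications of the mean value theorem: in direction \<open>v\<close> to the
  difference of \<open>g\<close> along opposite sides of the parallelogram, then in direction
  \<open>w\<close> to the directional derivative \<open>g' _ v\<close>.\<close>

lemma mixed_second_difference:
  fixes g :: "'v::real_normed_vector \<Rightarrow> real"
  assumes s: "s > 0"
    and g': "\<And>\<xi> \<eta>. \<lbrakk>\<xi> \<in> {0..s}; \<eta> \<in> {0..s}\<rbrakk> \<Longrightarrow>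
      (g has_derivative g' (p + \<xi> *\<^sub>R v + \<eta> *\<^sub>R w)) (at (p + \<xi> *\<^sub>R v + \<eta> *\<^sub>R w))"
    and g'': "\<And>\<xi> \<eta>. \<lbrakk>\<xi> \<in> {0..s}; \<eta> \<in> {0..s}\<rbrakk> \<Longrightarrow>
      ((\<lambda>q. g' q v) has_derivative g'' (p + \<xi> *\<^sub>R v + \<eta> *\<^sub>R w)) (at (p + \<xi> *\<^sub>R v + \<eta> *\<^sub>R w))"
  shows "\<exists>\<xi>\<in>{0..s}. \<exists>\<eta>\<in>{0..s}.
    g (p + s *\<^sub>R v + s *\<^sub>R w) - g (p + s *\<^sub>R v) - (g (p + s *\<^sub>R w) - g p) =
    s\<^sup>2 * g'' (p + \<xi> *\<^sub>R v + \<eta> *\<^sub>R w) w"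
proof -
  \<comment> \<open>The summand \<open>0 *\<^sub>R w\<close> gives both terms the shape handled by
    \<open>g1\<close>, with \<open>\<eta>\<close> equal to \<open>s\<close> and to 0.\<close>
  define D where "D t = g (p + t *\<^sub>R v + s *\<^sub>R w) - g (p + t *\<^sub>R v + 0 *\<^sub>R w)" for t
  have g1: "((\<lambda>t. g (p + t *\<^sub>R v + \<eta> *\<^sub>R w)) has_derivative (\<lambda>h. h * g' (p + t *\<^sub>R v + \<eta> *\<^sub>R w) v))
      (at t within {0..s})" if "t \<in> {0..s}" "\<eta> \<in> {0..s}" for t \<eta>
  proof -
    have "((\<lambda>t. g (p + t *\<^sub>R v + \<eta> *\<^sub>R w)) has_derivative
        (\<lambda>h. g' (p + t *\<^sub>R v + \<eta> *\<^sub>R w) (h *\<^sub>R v))) (at t within {0..s})"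
      by (rule has_derivative_compose[where f="\<lambda>t. p + t *\<^sub>R v + \<eta> *\<^sub>R w", OF _ g'[OF that]])
        (auto intro!: derivative_eq_intros)
    then show ?thesis
      using linear_cmul[OF has_derivative_linear[OF g'[OF that]]] by simp
  qed
  have "\<exists>\<xi>\<in>{0..s}. D s - D 0 =
      (s - 0) * g' (p + \<xi> *\<^sub>R v + s *\<^sub>R w) v - (s - 0) * g' (p + \<xi> *\<^sub>R v + 0 *\<^sub>R w) v"
    unfolding D_def using s
    by (intro mvt_very_simple has_derivative_diff g1) auto
  then obtain \<xi> where \<xi>: "\<xi> \<in> {0..s}" and
    D: "D s - D 0 = s * (g' (p + \<xi> *\<^sub>R v + s *\<^sub>R w) v - g' (p + \<xi> *\<^sub>R v + 0 *\<^sub>R w) v)"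
    by (auto simp: algebra_simps)
  have g2: "((\<lambda>\<eta>. g' (p + \<xi> *\<^sub>R v + \<eta> *\<^sub>R w) v) has_derivative
      (\<lambda>h. h * g'' (p + \<xi> *\<^sub>R v + \<eta> *\<^sub>R w) w)) (at \<eta> within {0..s})" if "\<eta> \<in> {0..s}" for \<eta>
  proof -
    have "((\<lambda>\<eta>. g' (p + \<xi> *\<^sub>R v + \<eta> *\<^sub>R w) v) has_derivative
        (\<lambda>h. g'' (p + \<xi> *\<^sub>R v + \<eta> *\<^sub>R w) (h *\<^sub>R w))) (at \<eta> within {0..s})"
      by (rule has_derivative_compose[where f="\<lambda>\<eta>. p + \<xi> *\<^sub>R v + \<eta> *\<^sub>R w", OF _ g''[OF \<xi> that]])
        (auto intro!: derivative_eq_intros)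
    then show ?thesis
      using linear_cmul[OF has_derivative_linear[OF g''[OF \<xi> that]]] by simp
  qed
  have "\<exists>\<eta>\<in>{0..s}. g' (p + \<xi> *\<^sub>R v + s *\<^sub>R w) v - g' (p + \<xi> *\<^sub>R v + 0 *\<^sub>R w) v =
      (s - 0) * g'' (p + \<xi> *\<^sub>R v + \<eta> *\<^sub>R w) w"
    using s by (intro mvt_very_simple g2) auto
  then obtain \<eta> where "\<eta> \<in> {0..s}" "D s - D 0 = s * (s * g'' (p + \<xi> *\<^sub>R v + \<eta> *\<^sub>R w) w)"
    unfolding D by auto
  moreover have "D s - D 0 = g (p + s *\<^sub>R v + s *\<^sub>R w) - g (p + s *\<^sub>R v) - (g (p + s *\<^sub>R w) - g p)"
    by (simp add: D_def)
  ultimately show ?thesis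
    using \<xi> unfolding power2_eq_square mult.assoc by metis
qed

lemma has_derivative_slices:
  assumes "(f has_derivative f') (at (p, r))"
  shows "((\<lambda>p. f (p, r)) has_derivative (\<lambda>h. f' (h, 0))) (at p)"
    and "((\<lambda>r. f (p, r)) has_derivative (\<lambda>h. f' (0, h))) (at r)"
proof -
  have "((\<lambda>p. (p, r)) has_derivative (\<lambda>h. (h, 0))) (at p)"
    "((\<lambda>r. (p, r)) has_derivative (\<lambda>h. (0, h))) (at r)"
    by (intro has_derivative_Pair has_derivative_ident has_derivative_const)+
  from this[THEN has_derivative_compose, OF assms]
  show "((\<lambda>p. f (p, r)) has_derivative (\<lambda>h. f' (h, 0))) (at p)"
    "((\<lambda>r. f (p, r)) has_derivative (\<lambda>h. f' (0, h))) (at r)" by auto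
qed

text \<open>The second difference over the parallelogram is unchanged when \<open>v\<close> and
  \<open>w\<close> are swapped. Evaluating it in both orders yields two points near \<open>p\<close>
  at which \<open>g'' _ v w\<close> and \<open>g'' _ w v\<close> take the same value; continuity
  carries the equality to \<open>p\<close>.\<close>

lemma symmetric_second_derivative:
  fixes g :: "'v::real_normed_vector \<Rightarrow> real"
  assumes W: "open W" "p \<in> W"
    and g': "\<And>q. q \<in> W \<Longrightarrow> (g has_derivative g' q) (at q)"
    and g'': "\<And>q a. q \<in> W \<Longrightarrow> ((\<lambda>q. g' q a) has_derivative g'' q a) (at q)"
    and cont: "\<And>a b. continuous_on W (\<lambda>q. g'' q a b)"
  shows "g'' p v w = g'' p w v"
proof -
  have "\<bar>g'' p v w - g'' p w v\<bar> \<le> e" if "e > 0" for e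
  proof -
    obtain r0 where r0: "r0 > 0" "ball p r0 \<subseteq> W" using W openE by blast
    have near: "\<exists>r>0. \<forall>q. dist q p < r \<longrightarrow> \<bar>g'' q a b - g'' p a b\<bar> < e / 2" for a b
    proof -
      have "continuous (at p) (\<lambda>q. g'' q a b)"
        using cont W by (simp add: continuous_on_eq_continuous_at)
      then show ?thesis
        using \<open>e > 0\<close> unfolding continuous_at_eps_delta dist_real_def by (meson half_gt_zero)
    qed
    obtain r1 where r1: "r1 > 0" "\<And>q. dist q p < r1 \<Longrightarrow> \<bar>g'' q v w - g'' p v w\<bar> < e / 2"
      using near[of v w] by blast
    obtain r2 where r2: "r2 > 0" "\<And>q. dist q p < r2 \<Longrightarrow> \<bar>g'' q w v - g'' p w v\<bar> < e / 2"
      using near[of w v] by blast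
    define r where "r = min r0 (min r1 r2)"
    \<comment> \<open>This makes \<open>s * (norm v + norm w) < r\<close>, so the whole
      parallelogram lies within \<open>r\<close> of \<open>p\<close>; the summand 1 keeps the
      denominator positive when both vectors vanish.\<close>
    define s where "s = r / (norm v + norm w + 1) / 2"
    have N: "norm v + norm w + 1 > 0" by (smt (verit) norm_ge_zero)
    have r: "r > 0" and s: "s > 0" using r0 r1 r2 N by (auto simp: r_def s_def)
    \<comment> \<open>The directions are left general so that the bound serves both orders of
      \<open>v\<close> and \<open>w\<close>.\<close>
    have close: "dist (p + \<xi> *\<^sub>R a + \<eta> *\<^sub>R b) p < r"
      if "\<xi> \<in> {0..s}" "\<eta> \<in> {0..s}" "norm a + norm b = norm v + norm w" for \<xi> \<eta> a b
    proof -
      have "dist (p + \<xi> *\<^sub>R a + \<eta> *\<^sub>R b) p \<le> norm (\<xi> *\<^sub>R a) + norm (\<eta> *\<^sub>R b)"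
        by (metis add.assoc add_diff_cancel_left' dist_norm norm_triangle_ineq)
      also have "\<dots> \<le> s * norm a + s * norm b"
        using that by (auto intro!: add_mono mult_right_mono)
      also have "\<dots> = s * (norm v + norm w)" using that(3) by (metis distrib_left)
      also have "\<dots> < s * ((norm v + norm w + 1) * 2)"
        using s by (intro mult_strict_left_mono) (auto simp: add_nonneg_pos)
      also have "\<dots> = r" using N unfolding s_def by (simp add: field_simps)
      finally show ?thesis .
    qed
    have inW: "p + \<xi> *\<^sub>R a + \<eta> *\<^sub>R b \<in> W"
      if "\<xi> \<in> {0..s}" "\<eta> \<in> {0..s}" "norm a + norm b = norm v + norm w" for \<xi> \<eta> a b
      using close[OF that] r0(2) by (auto simp: r_def dist_commute)
    have "\<exists>\<xi>\<in>{0..s}. \<exists>\<eta>\<in>{0..s}.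
      g (p + s *\<^sub>R v + s *\<^sub>R w) - g (p + s *\<^sub>R v) - (g (p + s *\<^sub>R w) - g p) =
      s\<^sup>2 * (\<lambda>q. g'' q v) (p + \<xi> *\<^sub>R v + \<eta> *\<^sub>R w) w"
      using inW s by (intro mixed_second_difference[where g'=g'] g' g'') auto
    then obtain \<xi> \<eta> where 1: "\<xi> \<in> {0..s}" "\<eta> \<in> {0..s}"
      "g (p + s *\<^sub>R v + s *\<^sub>R w) - g (p + s *\<^sub>R v) - (g (p + s *\<^sub>R w) - g p) =
      s\<^sup>2 * g'' (p + \<xi> *\<^sub>R v + \<eta> *\<^sub>R w) v w" by auto
    have "\<exists>\<xi>\<in>{0..s}. \<exists>\<eta>\<in>{0..s}.
      g (p + s *\<^sub>R w + s *\<^sub>R v) - g (p + s *\<^sub>R w) - (g (p + s *\<^sub>R v) - g p) =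
      s\<^sup>2 * (\<lambda>q. g'' q w) (p + \<xi> *\<^sub>R w + \<eta> *\<^sub>R v) v"
      using inW s by (intro mixed_second_difference[where g'=g'] g' g'') auto
    then obtain \<xi>' \<eta>' where 2: "\<xi>' \<in> {0..s}" "\<eta>' \<in> {0..s}"
      "g (p + s *\<^sub>R w + s *\<^sub>R v) - g (p + s *\<^sub>R w) - (g (p + s *\<^sub>R v) - g p) =
      s\<^sup>2 * g'' (p + \<xi>' *\<^sub>R w + \<eta>' *\<^sub>R v) w v" by auto
    have "s\<^sup>2 * g'' (p + \<xi> *\<^sub>R v + \<eta> *\<^sub>R w) v w = s\<^sup>2 * g'' (p + \<xi>' *\<^sub>R w + \<eta>' *\<^sub>R v) w v"
      unfolding 1(3)[symmetric] 2(3)[symmetric] by (simp add: algebra_simps)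
    then have "g'' (p + \<xi> *\<^sub>R v + \<eta> *\<^sub>R w) v w = g'' (p + \<xi>' *\<^sub>R w + \<eta>' *\<^sub>R v) w v"
      using s by simp
    moreover have "\<bar>g'' (p + \<xi> *\<^sub>R v + \<eta> *\<^sub>R w) v w - g'' p v w\<bar> < e / 2"
      using close[OF 1(1,2)] by (intro r1(2)) (auto simp: r_def)
    moreover have "\<bar>g'' (p + \<xi>' *\<^sub>R w + \<eta>' *\<^sub>R v) w v - g'' p w v\<bar> < e / 2"
      using close[OF 2(1,2), of w v] by (intro r2(2)) (auto simp: r_def add.commute)
    ultimately show ?thesis by argo
  qed
  then show ?thesis
    by (metis abs_le_zero_iff dense_ge eq_iff_diff_eq_0)
qed

section \<open>Covector-valued maps by components\<close>

text \<open>Expansion in the dual basis. As the sum is finite, derivatives and limits of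
  covector-valued maps can be checked after evaluation at each fixed vector.\<close>

lemma covector_eq_sum:
  fixes L :: "'e::euclidean_space \<Rightarrow>\<^sub>L real"
  shows "L = (\<Sum>i\<in>Basis. L i *\<^sub>R blinfun_inner_left i)"
proof (rule blinfun_eqI)
  fix a
  have "L a = L (\<Sum>i\<in>Basis. (a \<bullet> i) *\<^sub>R i)" by (simp add: euclidean_representation)
  also have "\<dots> = (\<Sum>i\<in>Basis. L i *\<^sub>R blinfun_inner_left i) a"
    by (simp add: blinfun.sum_right blinfun.sum_left blinfun.scaleR_right blinfun.scaleR_left inner_commute mult.commute)
  finally show "L a = (\<Sum>i\<in>Basis. L i *\<^sub>R blinfun_inner_left i) a" .
qed

lemma has_derivative_covectorI:
  fixes L M :: "'v::real_normed_vector \<Rightarrow> 'e::euclidean_space \<Rightarrow>\<^sub>L real"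
  assumes "\<And>a. ((\<lambda>x. L x a) has_derivative (\<lambda>h. M h a)) F"
  shows "(L has_derivative M) F"
proof -
  have "((\<lambda>x. \<Sum>i\<in>Basis. L x i *\<^sub>R (blinfun_inner_left i :: 'e \<Rightarrow>\<^sub>L real)) has_derivative
      (\<lambda>h. \<Sum>i\<in>Basis. M h i *\<^sub>R (blinfun_inner_left i :: 'e \<Rightarrow>\<^sub>L real))) F"
    by (intro has_derivative_sum has_derivative_scaleR_left assms)
  then show ?thesis unfolding covector_eq_sum[symmetric] .
qed

lemma tendsto_covectorI:
  fixes L :: "'x \<Rightarrow> 'e::euclidean_space \<Rightarrow>\<^sub>L real" and M :: "'e \<Rightarrow>\<^sub>L real"
  assumes "\<And>a. ((\<lambda>x. L x a) \<longlongrightarrow> M a) F"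
  shows "(L \<longlongrightarrow> M) F"
proof -
  have "((\<lambda>x. \<Sum>i\<in>Basis. L x i *\<^sub>R (blinfun_inner_left i :: 'e \<Rightarrow>\<^sub>L real)) \<longlongrightarrow>
      (\<Sum>i\<in>Basis. M i *\<^sub>R (blinfun_inner_left i :: 'e \<Rightarrow>\<^sub>L real))) F"
    by (intro tendsto_intros assms)
  then show ?thesis unfolding covector_eq_sum[symmetric] .
qed

section \<open>Functions that factor through a submersion\<close>

text \<open>Brouwer's fixed point theorem: solutions of \<open>G w = q\<close> are the fixed points
  of \<open>w \<mapsto> q + (w - G w)\<close>, which maps a small ball of radius
  \<open>2 * norm (q - G 0)\<close> into itself, because \<open>G\<close> deviates from its
  linearization by at most half of \<open>norm w\<close>.\<close>

lemma local_right_inverse: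
  fixes G :: "'n::euclidean_space \<Rightarrow> 'n"
  assumes N: "open N" "0 \<in> N" and cont: "continuous_on N G"
    and G: "(G has_derivative (\<lambda>w. w)) (at 0)"
  shows "eventually (\<lambda>q. \<exists>w\<in>N. G w = q \<and> norm w \<le> 2 * norm (q - G 0)) (nhds (G 0))"
proof -
  obtain r0 where r0: "r0 > 0" "cball 0 r0 \<subseteq> N"
    using N open_contains_cball by blast
  obtain r1 where r1: "r1 > 0" "\<And>w. norm w < r1 \<Longrightarrow> norm (G w - G 0 - w) \<le> 1 / 2 * norm w"
    using has_derivative_at_alt[THEN iffD1, OF G] by (metis diff_zero half_gt_zero zero_less_one)
  define r where "r = min r0 (r1 / 2)"
  have r: "r > 0" "r \<le> r0" "r < r1" using r0 r1 by (auto simp: r_def)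
  have "\<exists>w\<in>N. G w = q \<and> norm w \<le> 2 * norm (q - G 0)" if q: "dist q (G 0) < r / 2" for q
  proof (cases "q = G 0")
    case True
    then show ?thesis using N by (intro bexI[of _ 0]) auto
  next
    case False
    \<comment> \<open>One half of \<open>e\<close> pays for \<open>q - G 0\<close>, the other for
      the linearization error on the ball. The excluded case \<open>q = G 0\<close> would give
      radius 0.\<close>
    define e where "e = 2 * norm (q - G 0)"
    have e: "e > 0" "e \<le> r" using False q by (auto simp: e_def dist_norm)
    have "\<exists>w\<in>cball 0 e. G w = q"
    proof (rule brouwer_surjective_cball)
      show "continuous_on (cball 0 e) G"
        using cont continuous_on_subset r e r0(2) by (metis cball_subset_cball_iff dist_self add_0 dual_order.trans)
      show "q \<in> {q}" by simp
    next
      fix x w :: 'n assume xw: "x \<in> {q}" "w \<in> cball 0 e"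
      have "norm (x + (w - G w)) = norm ((q - G 0) - (G w - G 0 - w))"
        using xw by (auto intro!: arg_cong[where f=norm])
      also have "\<dots> \<le> norm (q - G 0) + norm (G w - G 0 - w)" by (rule norm_triangle_ineq4)
      also have "\<dots> \<le> e / 2 + e / 2"
        using r1(2)[of w] xw e r by (auto simp: e_def)
      finally show "x + (w - G w) \<in> cball 0 e" by simp
    qed (use e in auto)
    then obtain w where "norm w \<le> e" "G w = q" by auto
    moreover have "w \<in> N" using \<open>norm w \<le> e\<close> e r r0 by (auto simp: subset_iff)
    ultimately show ?thesis unfolding e_def by blast
  qed
  then show ?thesis unfolding eventually_nhds_metric using r(1)
    by (intro exI[of _ "r / 2"]) auto
qed

text \<open>\<open>\<beta>\<close> inherits differentiability from \<open>h\<close> although \<open>F\<close> need not have a continuous local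
  section: a possibly discontinuous section with a Lipschitz estimate at one point suffices.\<close>

lemma has_derivative_factor_submersion:
  fixes F :: "'e::euclidean_space \<Rightarrow> 'n::euclidean_space" and h :: "'e \<Rightarrow> 'w::real_normed_vector"
  assumes N: "open N" "u \<in> N" and cont: "continuous_on N F"
    and F: "(F has_derivative F') (at u)" and S: "linear S" "\<And>w. F' (S w) = w"
    and h: "(h has_derivative h') (at u)"
    and eq: "\<And>x. x \<in> N \<Longrightarrow> \<beta> (F x) = h x"
  shows "(\<beta> has_derivative (\<lambda>p. h' (S p))) (at (F u))"
proof -
  define M where "M = (\<lambda>w. u + S w) -` N"
  \<comment> \<open>Restricting \<open>F\<close> to the slice \<open>u + S w\<close> gives
    derivative \<open>F' \<circ> S\<close>, the identity, as \<open>local_right_inverse\<close>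
    requires.\<close>
  define G where "G w = F (u + S w)" for w
  have bS: "bounded_linear S" using S(1) by (simp add: linear_conv_bounded_linear)
  have S0: "S 0 = 0" using S(1) by (rule linear_0)
  have contS: "continuous_on UNIV (\<lambda>w. u + S w)"
    by (intro continuous_intros linear_continuous_on bS)
  have derS: "((\<lambda>w. u + S w) has_derivative S) (at x)" for x
    using bounded_linear_imp_has_derivative[OF bS] by (auto intro!: derivative_eq_intros)
  have M: "open M" "0 \<in> M"
    using N contS by (auto simp: M_def S0 intro: open_vimage)
  have contG: "continuous_on M G"
    unfolding G_def by (rule continuous_on_compose2[OF cont continuous_on_subset[OF contS]]) (auto simp: M_def)
  have derG: "(G has_derivative (\<lambda>w. w)) (at 0)"
    unfolding G_def
    using has_derivative_compose[OF derS[of 0], of F F'] F S by (simp add: S0)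
  define H where "H w = h (u + S w)" for w
  have derH: "(H has_derivative (\<lambda>w. h' (S w))) (at 0)"
    unfolding H_def
    using has_derivative_compose[OF derS[of 0], of h h'] h by (simp add: S0)
  have eqM: "\<beta> (G w) = H w" if "w \<in> M" for w
    using that eq by (auto simp: M_def G_def H_def)
  have G0: "G 0 = F u" by (simp add: G_def S0)
  have bH: "bounded_linear (\<lambda>w. h' (S w))" using derH by (rule has_derivative_bounded_linear)
  then obtain K where K: "K > 0" "\<And>w. norm (h' (S w)) \<le> norm w * K"
    using bounded_linear.pos_bounded by blast
  have "\<exists>d>0. \<forall>q. norm (q - G 0) < d \<longrightarrow>
      norm (\<beta> q - \<beta> (G 0) - h' (S (q - G 0))) \<le> e * norm (q - G 0)" if e: "e > 0" for e
  proof -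
    \<comment> \<open>With these values each error is at most \<open>e / 4 * norm w\<close>, and
      \<open>norm w \<le> 2 * norm (q - G 0)\<close> turns their sum into the required
      bound.\<close>
    define e1 where "e1 = e / 4"
    define e2 where "e2 = e / (4 * K)"
    have e12: "e1 > 0" "e2 > 0" using e K by (auto simp: e1_def e2_def)
    obtain d1 where d1: "d1 > 0" "\<And>w. norm w < d1 \<Longrightarrow> norm (H w - H 0 - h' (S w)) \<le> e1 * norm w"
      using has_derivative_at_alt[THEN iffD1, OF derH] e12(1) by (metis diff_zero)
    obtain d2 where d2: "d2 > 0" "\<And>w. norm w < d2 \<Longrightarrow> norm (G w - G 0 - w) \<le> e2 * norm w"
      using has_derivative_at_alt[THEN iffD1, OF derG] e12(2) by (metis diff_zero)
    obtain d3 where d3: "d3 > 0"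
      "\<And>q. dist q (G 0) < d3 \<Longrightarrow> \<exists>w\<in>M. G w = q \<and> norm w \<le> 2 * norm (q - G 0)"
      using local_right_inverse[OF M contG derG] unfolding eventually_nhds_metric by blast
    have "norm (\<beta> q - \<beta> (G 0) - h' (S (q - G 0))) \<le> e * norm (q - G 0)"
      \<comment> \<open>The preimage \<open>w\<close> can be twice as long as
        \<open>q - G 0\<close>; hence the halves of \<open>d1\<close> and \<open>d2\<close>.\<close>
      if q: "norm (q - G 0) < min d3 (min (d1 / 2) (d2 / 2))" for q
    proof -
      obtain w where w: "w \<in> M" "G w = q" "norm w \<le> 2 * norm (q - G 0)"
        using d3(2)[of q] q by (auto simp: dist_norm)
      \<comment> \<open>The error splits into that of \<open>H\<close> at \<open>w\<close> and the
        image under \<open>h' \<circ> S\<close> of that of \<open>G\<close> at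
        \<open>w\<close>.\<close>
      have "\<beta> q - \<beta> (G 0) - h' (S (q - G 0)) = (H w - H 0 - h' (S w)) - h' (S (G w - G 0 - w))"
        using eqM[OF w(1)] eqM[OF M(2)] w(2) linear_diff[OF bounded_linear.linear[OF bH], of "q - G 0" w]
        by simp
      then have "norm (\<beta> q - \<beta> (G 0) - h' (S (q - G 0))) \<le>
          norm (H w - H 0 - h' (S w)) + norm (h' (S (G w - G 0 - w)))"
        by (metis norm_triangle_ineq4)
      also have "\<dots> \<le> e1 * norm w + norm (G w - G 0 - w) * K"
        using w(3) q d1(2)[of w] K(2) by (intro add_mono) auto
      also have "\<dots> \<le> e1 * norm w + (e2 * norm w) * K"
        using w(3) q d2(2)[of w] K(1) by (intro add_mono mult_right_mono) auto
      also have "\<dots> = e / 2 * norm w" using K(1) by (simp add: e1_def e2_def field_simps)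
      also have "\<dots> \<le> e / 2 * (2 * norm (q - G 0))" using w(3) e by (intro mult_left_mono) auto
      finally show ?thesis by simp
    qed
    then show ?thesis using d1 d2 d3 by (intro exI[of _ "min d3 (min (d1 / 2) (d2 / 2))"]) auto
  qed
  then show ?thesis
    unfolding has_derivative_at_alt G0[symmetric] using bH by blast
qed

section \<open>Riesz representatives and transposes\<close>

text \<open>The Riesz representative, undone by \<open>blinfun_inner_left\<close>. It moves
  covectors into the Euclidean model space, where the Brouwer argument and adjoints apply.\<close>

definition covector_repr :: "('f::euclidean_space \<Rightarrow>\<^sub>L real) \<Rightarrow> 'f" where
  "covector_repr L = (\<Sum>i\<in>Basis. L i *\<^sub>R i)"

lemma bounded_linear_covector_repr: "bounded_linear covector_repr"
  unfolding covector_repr_def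
  by (intro bounded_linear_sum bounded_linear_scaleR_left[THEN bounded_linear_compose]
      blinfun.bounded_linear_left)

lemma blinfun_inner_left_covector_repr [simp]: "blinfun_inner_left (covector_repr L) = L"
proof (rule blinfun_eqI)
  fix w
  have "blinfun_inner_left (covector_repr L) w = (\<Sum>i\<in>Basis. L i * (w \<bullet> i))"
    by (simp add: covector_repr_def inner_sum_right)
  also have "\<dots> = L (\<Sum>i\<in>Basis. (w \<bullet> i) *\<^sub>R i)"
    by (simp add: blinfun.sum_right blinfun.scaleR_right mult.commute)
  finally show "blinfun_inner_left (covector_repr L) w = L w" by (simp add: euclidean_representation)
qed

lemma inner_covector_repr [simp]: "w \<bullet> covector_repr L = L w"
  by (metis blinfun_inner_left.rep_eq blinfun_inner_left_covector_repr)

text \<open>Up to Riesz representation, \<open>T'\<close> is the adjoint of \<open>T\<close>, and in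
  finite dimension a linear map is onto iff its adjoint is injective.\<close>

lemma surj_if_transpose_inj:
  fixes T :: "'e::euclidean_space \<Rightarrow>\<^sub>L ('f::euclidean_space \<Rightarrow>\<^sub>L real)"
    and T' :: "'f \<Rightarrow>\<^sub>L ('e \<Rightarrow>\<^sub>L real)"
  assumes T: "\<And>a b. T a b = T' b a" and inj: "inj (blinfun_apply T')"
  obtains S where "linear S" "\<And>w. covector_repr (T (S w)) = w"
proof -
  define K where "K a = covector_repr (T a)" for a
  have K: "linear K"
    unfolding K_def by (intro bounded_linear.linear bounded_linear_compose[OF bounded_linear_covector_repr]
      blinfun.bounded_linear_right)
  have adj: "T' w a = a \<bullet> adjoint K w" for w a
    by (simp add: adjoint_works[OF K]) (simp add: K_def inner_commute T)
  have "inj (adjoint K)"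
  proof (rule injI)
    fix w w' assume "adjoint K w = adjoint K w'"
    then have "T' w = T' w'" by (intro blinfun_eqI) (simp add: adj)
    then show "w = w'" using inj by (simp add: inj_eq)
  qed
  then have "surj K" using K by simp
  then obtain S where "linear S" "K \<circ> S = id" using linear_surjective_right_inverse[OF K] by blast
  then show thesis using that unfolding K_def by (metis comp_apply id_apply)
qed

section \<open>Functions of class C^k\<close>

lemma Ck_on_Suc_imp: "Ck_on (Suc k) S f \<Longrightarrow> Ck_on k S f"
proof (induction k arbitrary: f)
  case 0
  then show ?case
    by (auto intro!: continuous_at_imp_continuous_on differentiable_imp_continuous_within)
qed simp

lemma Ck_on_mono: "k \<le> l \<Longrightarrow> Ck_on l S f \<Longrightarrow> Ck_on k S f"
  by (induction rule: dec_induct) (blast dest: Ck_on_Suc_imp)+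

lemma Ck_on_2D:
  assumes "Ck_on 2 W g"
  defines "g' \<equiv> \<lambda>q. frechet_derivative g (at q)"
  defines "g'' \<equiv> \<lambda>q a. frechet_derivative (\<lambda>q. frechet_derivative g (at q) a) (at q)"
  shows "q \<in> W \<Longrightarrow> (g has_derivative g' q) (at q)"
    and "q \<in> W \<Longrightarrow> ((\<lambda>q. g' q a) has_derivative g'' q a) (at q)"
    and "continuous_on W (\<lambda>q. g'' q a b)"
  using assms(1) unfolding g'_def g''_def numeral_2_eq_2 Ck_on.simps
  by (blast intro: frechet_derivative_works[THEN iffD1])+

lemma Ck_on_product_mono:
  assumes "k \<le> l" "Ck_on_product l A S B T c"
  shows "Ck_on_product k A S B T c"
  unfolding Ck_on_product_def
proof (intro ballI)
  fix p q assume "p \<in> S" "q \<in> T"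
  obtain U \<phi> V \<psi> W g where "(U, \<phi>) \<in> A" "(V, \<psi>) \<in> B" "p \<in> U" "q \<in> V" "open W"
    "(\<phi> p, \<psi> q) \<in> W" "Ck_on l W g"
    "\<forall>x\<in>S \<inter> U. \<forall>y\<in>T \<inter> V. (\<phi> x, \<psi> y) \<in> W \<longrightarrow> c x y = g (\<phi> x, \<psi> y)"
    using assms(2)[unfolded Ck_on_product_def, rule_format, OF \<open>p \<in> S\<close> \<open>q \<in> T\<close>] by blast
  moreover from \<open>Ck_on l W g\<close> have "Ck_on k W g" by (rule Ck_on_mono[OF assms(1)])
  ultimately show "\<exists>(U, \<phi>)\<in>A. \<exists>(V, \<psi>)\<in>B. p \<in> U \<and> q \<in> V \<and>
      (\<exists>W g. open W \<and> (\<phi> p, \<psi> q) \<in> W \<and> Ck_on k W g \<and>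
        (\<forall>x\<in>S \<inter> U. \<forall>y\<in>T \<inter> V. (\<phi> x, \<psi> y) \<in> W \<longrightarrow> c x y = g (\<phi> x, \<psi> y)))"
    by blast
qed

section \<open>Differentials in charts\<close>

lemma chart_at_mem:
  assumes "smooth_manifold S A" "x \<in> S"
  shows "chart_at A x \<in> A" "x \<in> fst (chart_at A x)"
proof -
  have "\<exists>\<kappa>. \<kappa> \<in> A \<and> x \<in> fst \<kappa>"
    using assms unfolding smooth_manifold_def by blast
  then have "chart_at A x \<in> A \<and> x \<in> fst (chart_at A x)"
    unfolding chart_at_def by (rule someI_ex)
  then show "chart_at A x \<in> A" "x \<in> fst (chart_at A x)" by auto
qed

lemma smooth_manifold_chartD:
  assumes "smooth_manifold S A" "\<kappa> \<in> A"
  shows "openin (top_of_set S) (fst \<kappa>)" "open (snd \<kappa> ` fst \<kappa>)"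
    "homeomorphism (fst \<kappa>) (snd \<kappa> ` fst \<kappa>) (snd \<kappa>) (inv_into (fst \<kappa>) (snd \<kappa>))"
    "inj_on (snd \<kappa>) (fst \<kappa>)" "fst \<kappa> \<subseteq> S"
proof -
  obtain U \<phi> where \<kappa>: "\<kappa> = (U, \<phi>)" by fastforce
  then have *: "openin (top_of_set S) U \<and> open (\<phi> ` U) \<and> homeomorphism U (\<phi> ` U) \<phi> (inv_into U \<phi>)"
    using assms unfolding smooth_manifold_def by blast
  then show "openin (top_of_set S) (fst \<kappa>)" "open (snd \<kappa> ` fst \<kappa>)"
    "homeomorphism (fst \<kappa>) (snd \<kappa> ` fst \<kappa>) (snd \<kappa>) (inv_into (fst \<kappa>) (snd \<kappa>))"
    by (auto simp: \<kappa>)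
  then show "inj_on (snd \<kappa>) (fst \<kappa>)" "fst \<kappa> \<subseteq> S"
    by (auto intro: inj_on_inverseI homeomorphism_apply1 dest: openin_imp_subset)
qed

lemma open_overlap:
  assumes "smooth_manifold S A" "\<kappa> \<in> A" "openin (top_of_set T) (fst \<mu>)" "S \<subseteq> T"
  shows "open (overlap \<kappa> \<mu>)"
proof -
  note \<kappa> = smooth_manifold_chartD[OF assms(1,2)]
  obtain O' where "open O'" "fst \<mu> = T \<inter> O'"
    using assms(3) by (auto simp: openin_open)
  then have "fst \<kappa> \<inter> fst \<mu> = fst \<kappa> \<inter> O'" using \<kappa>(5) assms(4) by auto
  then have "openin (top_of_set (fst \<kappa>)) (fst \<kappa> \<inter> fst \<mu>)"
    using \<open>open O'\<close> by (auto simp: openin_open)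
  then have "openin (top_of_set (snd \<kappa> ` fst \<kappa>)) (overlap \<kappa> \<mu>)"
    unfolding overlap_def by (rule homeomorphism_imp_open_map[OF \<kappa>(3)])
  then show ?thesis using \<kappa>(2) openin_open_trans by blast
qed

text \<open>Chain rule: near \<open>snd \<kappa> x\<close> the coordinate expression of
  \<open>f\<close> is \<open>G\<close> after the transition map. Taking \<open>T\<close> larger than
  \<open>S\<close> covers charts of the ambient manifold, and \<open>T = S\<close> covers a change
  of chart within one manifold.\<close>

lemma has_derivative_in_chart:
  assumes S: "smooth_manifold S A" "\<kappa> \<in> A" and \<mu>: "openin (top_of_set T) (fst \<mu>)" "S \<subseteq> T"
    and x: "x \<in> fst \<kappa>" "x \<in> fst \<mu>"
    and \<tau>: "transition \<kappa> \<mu> differentiable (at (snd \<kappa> x))"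
    and G: "(G has_derivative G') (at (snd \<mu> x))"
    and W: "open W" "snd \<mu> x \<in> W"
    and eq: "\<And>x'. \<lbrakk>x' \<in> fst \<kappa>; x' \<in> fst \<mu>; snd \<mu> x' \<in> W\<rbrakk> \<Longrightarrow> f x' = G (snd \<mu> x')"
  shows "((f \<circ> inv_into (fst \<kappa>) (snd \<kappa>)) has_derivative
    (\<lambda>h. G' (frechet_derivative (transition \<kappa> \<mu>) (at (snd \<kappa> x)) h))) (at (snd \<kappa> x))"
proof -
  let ?\<tau> = "transition \<kappa> \<mu>" and ?u = "snd \<kappa> x"
  note \<kappa> = smooth_manifold_chartD[OF S]
  have \<tau>u: "?\<tau> (snd \<kappa> x') = snd \<mu> x'" if "x' \<in> fst \<kappa>" for x'
    using \<kappa>(4) that by (simp add: transition_def)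
  have d\<tau>: "(?\<tau> has_derivative frechet_derivative ?\<tau> (at ?u)) (at ?u)"
    using \<tau> frechet_derivative_works by blast
  have *: "((\<lambda>u. G (?\<tau> u)) has_derivative (\<lambda>h. G' (frechet_derivative ?\<tau> (at ?u) h))) (at ?u)"
    using G by (intro has_derivative_compose[OF d\<tau>]) (simp add: \<tau>u x)
  have "open (overlap \<kappa> \<mu>)" using S \<mu> by (rule open_overlap)
  then have 1: "\<forall>\<^sub>F u in at ?u. u \<in> overlap \<kappa> \<mu>"
    using x by (intro eventually_at_in_open') (auto simp: overlap_def)
  have "(?\<tau> \<longlongrightarrow> ?\<tau> ?u) (at ?u)"
    using differentiable_imp_continuous_within[OF \<tau>] by (simp add: continuous_within)
  then have 2: "\<forall>\<^sub>F u in at ?u. ?\<tau> u \<in> W"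
    using W x by (auto simp: \<tau>u intro: topological_tendstoD)
  have "\<forall>\<^sub>F u in at ?u. G (?\<tau> u) = (f \<circ> inv_into (fst \<kappa>) (snd \<kappa>)) u"
    using 1 2
  proof eventually_elim
    case (elim u)
    then obtain x' where x': "x' \<in> fst \<kappa>" "x' \<in> fst \<mu>" "u = snd \<kappa> x'" by (auto simp: overlap_def)
    then show ?case using elim eq[of x'] \<kappa>(4) by (simp add: \<tau>u)
  qed
  then show ?thesis
    using eq[OF x W(2)] x \<kappa>(4) by (intro has_derivative_transform_eventually[OF *]) (auto simp: \<tau>u)
qed

lemma has_differential_alt:
  "has_differential A f x D \<longleftrightarrow>
    ((f \<circ> inv_into (fst (chart_at A x)) (snd (chart_at A x))) has_derivative blinfun_apply D)
      (at (snd (chart_at A x) x))"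
  by (simp add: has_differential_def case_prod_beta)

lemma has_differential_unique:
  "has_differential A f x D \<Longrightarrow> has_differential A f x D' \<Longrightarrow> D = D'"
  unfolding has_differential_alt
  by (rule blinfun_eqI, drule (1) has_derivative_unique) simp

lemma differential_eq: "has_differential A f x D \<Longrightarrow> differential A f x = D"
  unfolding differential_def by (rule the_equality) (auto intro: has_differential_unique)

lemma smoothly_embedded_differentiable:
  assumes "smoothly_embedded S A T B" "\<kappa> \<in> A" "\<mu> \<in> B" "x \<in> fst \<kappa>" "x \<in> fst \<mu>"
  shows "transition \<kappa> \<mu> differentiable (at (snd \<kappa> x))"
proof -
  have "Ck_on 1 (overlap \<kappa> \<mu>) (transition \<kappa> \<mu>)"
    using assms unfolding smoothly_embedded_def smooth_on_def by blast
  then show ?thesis using assms(4,5) by (auto simp: overlap_def)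
qed

lemma has_derivative_in_embedded_chart:
  assumes "smooth_manifold S A" "smoothly_embedded S A T B" "smooth_manifold T B"
    and "\<kappa> \<in> A" "\<mu> \<in> B" "x \<in> fst \<kappa>" "x \<in> fst \<mu>"
    and "(G has_derivative G') (at (snd \<mu> x))" "open W" "snd \<mu> x \<in> W"
    and "\<And>x'. \<lbrakk>x' \<in> S; x' \<in> fst \<mu>; snd \<mu> x' \<in> W\<rbrakk> \<Longrightarrow> f x' = G (snd \<mu> x')"
  shows "((f \<circ> inv_into (fst \<kappa>) (snd \<kappa>)) has_derivative
    (\<lambda>h. G' (frechet_derivative (transition \<kappa> \<mu>) (at (snd \<kappa> x)) h))) (at (snd \<kappa> x))"
  using assms smooth_manifold_chartD(1)[OF assms(3,5)] smooth_manifold_chartD(5)[OF assms(1,4)]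
    smoothly_embedded_differentiable[OF assms(2,4-7)]
  by (intro has_derivative_in_chart[where S=S and A=A and T=T and W=W])
    (auto simp: smoothly_embedded_def)

section \<open>Vanishing differentials\<close>

text \<open>\<open>has_differential\<close> refers at every point to the preferred chart of that
  point, so the zero derivatives are first carried by transition maps into a single chart; there
  \<open>f\<close> is constant on a ball.\<close>

lemma locally_constant_if_zero_differential:
  fixes f :: "'b::{t2_space, second_countable_topology} \<Rightarrow> real"
  assumes S: "smooth_manifold S A" and f: "\<And>x. x \<in> S \<Longrightarrow> has_differential A f x 0"
    and x: "x \<in> S"
  shows "\<exists>T. openin (top_of_set S) T \<and> x \<in> T \<and> (\<forall>x'\<in>T. f x' = f x)"
proof -
  obtain \<kappa> where \<kappa>: "\<kappa> \<in> A" "x \<in> fst \<kappa>" using chart_at_mem[OF S x] by blast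
  note \<kappa>D = smooth_manifold_chartD[OF S \<kappa>(1)]
  let ?U = "fst \<kappa>" and ?\<phi> = "snd \<kappa>"
  obtain r where r: "r > 0" "ball (?\<phi> x) r \<subseteq> ?\<phi> ` ?U"
    using \<kappa>D(2) \<kappa>(2) openE by blast
  have zero: "((f \<circ> inv_into ?U ?\<phi>) has_derivative (\<lambda>_. 0)) (at (?\<phi> x'))" if x': "x' \<in> ?U" for x'
  proof -
    have x'S: "x' \<in> S" using x' \<kappa>D(5) by auto
    let ?\<mu> = "chart_at A x'"
    note \<mu> = chart_at_mem[OF S x'S]
    note \<mu>D = smooth_manifold_chartD[OF S \<mu>(1)]
    have "Ck_on 1 (overlap \<kappa> ?\<mu>) (transition \<kappa> ?\<mu>)"
      using S \<kappa>(1) \<mu>(1) unfolding smooth_manifold_def smooth_on_def by blast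
    then have "transition \<kappa> ?\<mu> differentiable (at (?\<phi> x'))"
      using x' \<mu>(2) by (auto simp: overlap_def)
    then show ?thesis
      using has_derivative_in_chart[OF S \<kappa>(1) \<mu>D(1) order_refl x' \<mu>(2) _
          f[OF x'S, unfolded has_differential_alt] open_UNIV, of f] \<mu>D(4)
      by simp
  qed
  have const: "(f \<circ> inv_into ?U ?\<phi>) u = (f \<circ> inv_into ?U ?\<phi>) (?\<phi> x)" if u: "u \<in> ball (?\<phi> x) r" for u
  proof (rule has_derivative_zero_unique_connected[where s="ball (?\<phi> x) r"])
    fix v assume "v \<in> ball (?\<phi> x) r"
    then show "((f \<circ> inv_into ?U ?\<phi>) has_derivative (\<lambda>x. 0)) (at v)"
      using r(2) zero by auto
  qed (use u r in auto)
  have "openin (top_of_set ?U) (?U \<inter> ?\<phi> -` ball (?\<phi> x) r)"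
    using \<kappa>D(3) by (intro continuous_openin_preimage_gen) (auto simp: homeomorphism_def)
  then have "openin (top_of_set S) (?U \<inter> ?\<phi> -` ball (?\<phi> x) r)"
    using \<kappa>D(1) openin_trans by blast
  moreover have "f x' = f x" if "x' \<in> ?U \<inter> ?\<phi> -` ball (?\<phi> x) r" for x'
    using const[of "?\<phi> x'"] that \<kappa>D(4) \<kappa>(2) by simp
  moreover have "x \<in> ?U \<inter> ?\<phi> -` ball (?\<phi> x) r" using \<kappa>(2) r(1) by simp
  ultimately show ?thesis by blast
qed

lemma constant_on_if_zero_differential:
  fixes f :: "'b::{t2_space, second_countable_topology} \<Rightarrow> real"
  assumes "smooth_manifold S A" "connected S" "\<And>x. x \<in> S \<Longrightarrow> has_differential A f x 0"
  shows "f constant_on S"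
  using assms by (intro locally_constant_imp_constant locally_constant_if_zero_differential)

lemma has_differential_BlinfunI:
  assumes "((f \<circ> inv_into (fst (chart_at A x)) (snd (chart_at A x))) has_derivative D)
    (at (snd (chart_at A x) x))"
  shows "has_differential A f x (Blinfun D)"
  using assms has_derivative_bounded_linear[OF assms]
  by (simp add: has_differential_alt bounded_linear_Blinfun_apply)

lemma has_differential_diff:
  "has_differential A f x D \<Longrightarrow> has_differential A g x D' \<Longrightarrow>
    has_differential A (\<lambda>x. f x - g x) x (D - D')"
  unfolding has_differential_alt minus_blinfun.rep_eq o_def by (rule has_derivative_diff)

text \<open>Serves to differentiate in \<open>y\<close> the affine relations between the covectors
  of \<open>c\<close> and of \<open>b\<close>. Agreement on \<open>S\<close> is enough because the
  chart has open image.\<close>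

lemma has_differential_linear_image:
  assumes S: "smooth_manifold S A" "x \<in> S" and f: "has_differential A f x D" and l: "bounded_linear l"
    and g: "\<And>x'. x' \<in> S \<Longrightarrow> g x' = l (f x') - k"
  shows "has_differential A g x (Blinfun (\<lambda>h. l (D h)))"
proof (rule has_differential_BlinfunI)
  let ?U = "fst (chart_at A x)" and ?\<phi> = "snd (chart_at A x)"
  note \<kappa> = chart_at_mem[OF S]
  note \<kappa>D = smooth_manifold_chartD[OF S(1) \<kappa>(1)]
  have "((\<lambda>u. l ((f \<circ> inv_into ?U ?\<phi>) u) - k) has_derivative (\<lambda>h. l (D h) - 0)) (at (?\<phi> x))"
    by (intro has_derivative_diff has_derivative_const
        bounded_linear.has_derivative[OF l f[unfolded has_differential_alt]])
  then have "((\<lambda>u. l ((f \<circ> inv_into ?U ?\<phi>) u) - k) has_derivative (\<lambda>h. l (D h))) (at (?\<phi> x))" by simp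
  then show "((g \<circ> inv_into ?U ?\<phi>) has_derivative (\<lambda>h. l (D h))) (at (?\<phi> x))"
  proof (rule has_derivative_transform_within_open[OF _ \<kappa>D(2)])
    show "?\<phi> x \<in> ?\<phi> ` ?U" using \<kappa>(2) by blast
    fix u assume "u \<in> ?\<phi> ` ?U"
    then have "inv_into ?U ?\<phi> u \<in> S" using inv_into_into \<kappa>D(5) by (metis subsetD)
    then show "l ((f \<circ> inv_into ?U ?\<phi>) u) - k = (g \<circ> inv_into ?U ?\<phi>) u" using g by simp
  qed
qed

section \<open>Differentials of the cost\<close>

locale smooth_cost =
  fixes \<M> :: "('a::{t2_space, second_countable_topology}, 'p::euclidean_space) chart set"
    and \<N> :: "('b::{t2_space, second_countable_topology}, 'q::euclidean_space) chart set"
    and \<X> :: "('a, 'e::euclidean_space) chart set" and X :: "'a set"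
    and \<Y> :: "('b, 'f::euclidean_space) chart set" and Y :: "'b set"
    and c :: "'a \<Rightarrow> 'b \<Rightarrow> real"
  assumes ambient: "smooth_manifold UNIV \<M>" "smooth_manifold UNIV \<N>"
    and manifolds: "smooth_manifold X \<X>" "smooth_manifold Y \<Y>"
    and embedded: "smoothly_embedded X \<X> UNIV \<M>" "smoothly_embedded Y \<Y> UNIV \<N>"
    and C2: "Ck_on_product 2 \<M> (closure X) \<N> (closure Y) c"

text \<open>Fixes one local representative \<open>g\<close> of \<open>c\<close> on an open set of
  ambient coordinates. All derivatives of \<open>c\<close> are computed from those of
  \<open>g\<close>, also when \<open>y\<close> is a boundary point of \<open>Y\<close>.\<close>

locale smooth_cost_rep = smooth_cost +
  fixes \<mu> \<nu> W g
  assumes charts: "\<mu> \<in> \<M>" "\<nu> \<in> \<N>" and open_W: "open W" and g_C2: "Ck_on 2 W g"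
    and rep: "\<And>x y. \<lbrakk>x \<in> closure X; y \<in> closure Y; x \<in> fst \<mu>; y \<in> fst \<nu>; (snd \<mu> x, snd \<nu> y) \<in> W\<rbrakk>
      \<Longrightarrow> c x y = g (snd \<mu> x, snd \<nu> y)"
begin

definition
  "rep_at x y \<longleftrightarrow> x \<in> fst \<mu> \<and> y \<in> fst \<nu> \<and> (snd \<mu> x, snd \<nu> y) \<in> W"

abbreviation "g' q \<equiv> frechet_derivative g (at q)"
abbreviation "g'' q a \<equiv> frechet_derivative (\<lambda>q. frechet_derivative g (at q) a) (at q)"
abbreviation "d\<mu> \<kappa> x \<equiv> frechet_derivative (transition \<kappa> \<mu>) (at (snd \<kappa> x))"
abbreviation "d\<nu> \<kappa> y \<equiv> frechet_derivative (transition \<kappa> \<nu>) (at (snd \<kappa> y))"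

lemmas g_deriv = Ck_on_2D[OF g_C2]

lemma g''_sym: "q \<in> W \<Longrightarrow> g'' q v w = g'' q w v"
  by (rule symmetric_second_derivative[where g''=g'' and g'=g', OF open_W _ g_deriv])

lemma open_slices: "open {p. (p, r) \<in> W}" "open {r. (p, r) \<in> W}"
proof -
  have "open ((\<lambda>p. (p, r)) -` W)" "open ((\<lambda>r. (p, r)) -` W)"
    by (intro open_vimage open_W continuous_intros)+
  then show "open {p. (p, r) \<in> W}" "open {r. (p, r) \<in> W}" by (simp_all add: vimage_def)
qed

lemma bounded_linear_transition:
  "\<kappa> \<in> \<X> \<Longrightarrow> x \<in> fst \<kappa> \<Longrightarrow> x \<in> fst \<mu> \<Longrightarrow> bounded_linear (d\<mu> \<kappa> x)"
  "\<kappa>' \<in> \<Y> \<Longrightarrow> y \<in> fst \<kappa>' \<Longrightarrow> y \<in> fst \<nu> \<Longrightarrow> bounded_linear (d\<nu> \<kappa>' y)"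
  by (rule has_derivative_bounded_linear, rule frechet_derivative_works[THEN iffD1],
      rule smoothly_embedded_differentiable[OF embedded(1) _ charts(1)], assumption+,
      rule has_derivative_bounded_linear, rule frechet_derivative_works[THEN iffD1],
      rule smoothly_embedded_differentiable[OF embedded(2) _ charts(2)])

lemma bounded_linear_g'':
  "\<lbrakk>q \<in> W; bounded_linear l\<rbrakk> \<Longrightarrow> bounded_linear (\<lambda>a. g'' q w (l a, 0))"
  "\<lbrakk>q \<in> W; bounded_linear l'\<rbrakk> \<Longrightarrow> bounded_linear (\<lambda>b. g'' q w (0, l' b))"
  by (rule bounded_linear_compose[OF has_derivative_bounded_linear[OF g_deriv(2)]], assumption,
      intro bounded_linear_Pair bounded_linear_zero, assumption)+

text \<open>Only \<open>x\<close> is differentiated, so \<open>y\<close> is a parameter and may lie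
  in the closure; this is what later gives continuity up to the boundary.\<close>

lemma Dx_rep:
  assumes x: "x \<in> X" and y: "y \<in> closure Y" and r: "rep_at x y"
  shows "has_differential \<X> (\<lambda>x. c x y) x (Dx \<X> c x y)"
    and "Dx \<X> c x y a = g' (snd \<mu> x, snd \<nu> y) (d\<mu> (chart_at \<X> x) x a, 0)"
proof -
  let ?\<kappa> = "chart_at \<X> x"
  note \<kappa> = chart_at_mem[OF manifolds(1) x]
  have r': "x \<in> fst \<mu>" "y \<in> fst \<nu>" "(snd \<mu> x, snd \<nu> y) \<in> W" using r by (auto simp: rep_at_def)
  have *: "(((\<lambda>x. c x y) \<circ> inv_into (fst ?\<kappa>) (snd ?\<kappa>)) has_derivative
      (\<lambda>h. g' (snd \<mu> x, snd \<nu> y) (d\<mu> ?\<kappa> x h, 0))) (at (snd ?\<kappa> x))"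
    by (rule has_derivative_in_embedded_chart[OF manifolds(1) embedded(1) ambient(1) \<kappa>(1) charts(1) \<kappa>(2) r'(1)
          has_derivative_slices(1)[OF g_deriv(1)[OF r'(3)]] open_slices(1)[of "snd \<nu> y"]])
      (use r' y in \<open>auto intro!: rep simp: closure_subset[THEN subsetD]\<close>)
  have D: "Dx \<X> c x y = Blinfun (\<lambda>h. g' (snd \<mu> x, snd \<nu> y) (d\<mu> ?\<kappa> x h, 0))"
    unfolding Dx_def by (rule differential_eq[OF has_differential_BlinfunI[OF *]])
  show "has_differential \<X> (\<lambda>x. c x y) x (Dx \<X> c x y)"
    unfolding D by (rule has_differential_BlinfunI[OF *])
  show "Dx \<X> c x y a = g' (snd \<mu> x, snd \<nu> y) (d\<mu> ?\<kappa> x a, 0)"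
    unfolding D by (simp add: bounded_linear_Blinfun_apply[OF has_derivative_bounded_linear[OF *]])
qed

lemma Dy_rep:
  assumes x: "x \<in> X" and y: "y \<in> Y" and r: "rep_at x y"
  shows "has_differential \<Y> (c x) y (Dy \<Y> c x y)"
    and "Dy \<Y> c x y b = g' (snd \<mu> x, snd \<nu> y) (0, d\<nu> (chart_at \<Y> y) y b)"
proof -
  let ?\<kappa> = "chart_at \<Y> y"
  note \<kappa> = chart_at_mem[OF manifolds(2) y]
  have r': "x \<in> fst \<mu>" "y \<in> fst \<nu>" "(snd \<mu> x, snd \<nu> y) \<in> W" using r by (auto simp: rep_at_def)
  have *: "((c x \<circ> inv_into (fst ?\<kappa>) (snd ?\<kappa>)) has_derivative
      (\<lambda>h. g' (snd \<mu> x, snd \<nu> y) (0, d\<nu> ?\<kappa> y h))) (at (snd ?\<kappa> y))"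
    by (rule has_derivative_in_embedded_chart[OF manifolds(2) embedded(2) ambient(2) \<kappa>(1) charts(2) \<kappa>(2) r'(2)
          has_derivative_slices(2)[OF g_deriv(1)[OF r'(3)]] open_slices(2)[of "snd \<mu> x"]])
      (use r' x in \<open>auto intro!: rep simp: closure_subset[THEN subsetD]\<close>)
  have D: "Dy \<Y> c x y = Blinfun (\<lambda>h. g' (snd \<mu> x, snd \<nu> y) (0, d\<nu> ?\<kappa> y h))"
    unfolding Dy_def by (rule differential_eq[OF has_differential_BlinfunI[OF *]])
  show "has_differential \<Y> (c x) y (Dy \<Y> c x y)"
    unfolding D by (rule has_differential_BlinfunI[OF *])
  show "Dy \<Y> c x y b = g' (snd \<mu> x, snd \<nu> y) (0, d\<nu> ?\<kappa> y b)"
    unfolding D by (simp add: bounded_linear_Blinfun_apply[OF has_derivative_bounded_linear[OF *]])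
qed

text \<open>For each fixed \<open>a\<close> the formula \<open>Dx_rep\<close> is differentiated once
  more in \<open>y\<close>, and the components are then assembled into a covector.\<close>

lemma Dxy_rep:
  assumes x: "x \<in> X" and y: "y \<in> Y" and r: "rep_at x y"
  shows "has_differential \<Y> (Dx \<X> c x) y (Dxy \<X> \<Y> c x y)"
    and "Dxy \<X> \<Y> c x y b a =
      g'' (snd \<mu> x, snd \<nu> y) (d\<mu> (chart_at \<X> x) x a, 0) (0, d\<nu> (chart_at \<Y> y) y b)"
proof -
  let ?\<kappa> = "chart_at \<X> x" and ?\<kappa>' = "chart_at \<Y> y" and ?q = "(snd \<mu> x, snd \<nu> y)"
  note \<kappa> = chart_at_mem[OF manifolds(1) x] and \<kappa>' = chart_at_mem[OF manifolds(2) y]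
  have r': "x \<in> fst \<mu>" "y \<in> fst \<nu>" "?q \<in> W" using r by (auto simp: rep_at_def)
  define M where "M b = Blinfun (\<lambda>a. g'' ?q (d\<mu> ?\<kappa> x a, 0) (0, d\<nu> ?\<kappa>' y b))" for b
  have M: "M b a = g'' ?q (d\<mu> ?\<kappa> x a, 0) (0, d\<nu> ?\<kappa>' y b)" for a b
  proof -
    have bl: "bounded_linear (d\<mu> ?\<kappa> x)" by (rule bounded_linear_transition(1)[OF \<kappa> r'(1)])
    \<comment> \<open>In its last argument \<open>g''\<close> is linear as a derivative; linearity
      in the direction differentiated first is obtained by symmetry.\<close>
    have "bounded_linear (\<lambda>a. g'' ?q (d\<mu> ?\<kappa> x a, 0) (0, d\<nu> ?\<kappa>' y b))"
      unfolding g''_sym[OF r'(3), of _ "(0, d\<nu> ?\<kappa>' y b)"] by (rule bounded_linear_g''(1)[OF r'(3) bl])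
    then show ?thesis unfolding M_def by (simp add: bounded_linear_Blinfun_apply)
  qed
  have component: "(((\<lambda>y. Dx \<X> c x y a) \<circ> inv_into (fst ?\<kappa>') (snd ?\<kappa>')) has_derivative (\<lambda>b. M b a))
      (at (snd ?\<kappa>' y))" for a
    unfolding M
    by (rule has_derivative_in_embedded_chart[OF manifolds(2) embedded(2) ambient(2) \<kappa>'(1) charts(2) \<kappa>'(2) r'(2)
          has_derivative_slices(2)[OF g_deriv(2)[OF r'(3)]] open_slices(2)[of "snd \<mu> x"]])
      (use r' x in \<open>simp_all add: Dx_rep(2) rep_at_def closure_subset[THEN subsetD]\<close>)
  then have *: "((Dx \<X> c x \<circ> inv_into (fst ?\<kappa>') (snd ?\<kappa>')) has_derivative M) (at (snd ?\<kappa>' y))"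
    by (intro has_derivative_covectorI) (simp add: o_def)
  have D: "Dxy \<X> \<Y> c x y = Blinfun M"
    unfolding Dxy_def by (rule differential_eq[OF has_differential_BlinfunI[OF *]])
  show "has_differential \<Y> (Dx \<X> c x) y (Dxy \<X> \<Y> c x y)"
    unfolding D by (rule has_differential_BlinfunI[OF *])
  show "Dxy \<X> \<Y> c x y b a = g'' ?q (d\<mu> ?\<kappa> x a, 0) (0, d\<nu> ?\<kappa>' y b)"
    unfolding D M[symmetric]
    by (simp add: bounded_linear_Blinfun_apply[OF has_derivative_bounded_linear[OF *]])
qed

text \<open>The chart \<open>\<kappa>\<close> is arbitrary, not the preferred one at
  \<open>x\<close>, because continuity in one fixed chart at all its points is derived from
  this.\<close>

lemma Dyx_rep:
  assumes \<kappa>: "\<kappa> \<in> \<X>" "x \<in> fst \<kappa>" and y: "y \<in> Y" and r: "rep_at x y"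
  obtains M where "(((\<lambda>x. Dy \<Y> c x y) \<circ> inv_into (fst \<kappa>) (snd \<kappa>)) has_derivative M) (at (snd \<kappa> x))"
    and "\<And>a b. M a b = g'' (snd \<mu> x, snd \<nu> y) (0, d\<nu> (chart_at \<Y> y) y b) (d\<mu> \<kappa> x a, 0)"
proof -
  let ?\<kappa>' = "chart_at \<Y> y" and ?q = "(snd \<mu> x, snd \<nu> y)"
  note \<kappa>' = chart_at_mem[OF manifolds(2) y]
  have r': "x \<in> fst \<mu>" "y \<in> fst \<nu>" "?q \<in> W" using r by (auto simp: rep_at_def)
  define M where "M a = Blinfun (\<lambda>b. g'' ?q (0, d\<nu> ?\<kappa>' y b) (d\<mu> \<kappa> x a, 0))" for a
  have M: "M a b = g'' ?q (0, d\<nu> ?\<kappa>' y b) (d\<mu> \<kappa> x a, 0)" for a b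
  proof -
    have bl: "bounded_linear (d\<nu> ?\<kappa>' y)" by (rule bounded_linear_transition(2)[OF \<kappa>' r'(2)])
    have "bounded_linear (\<lambda>b. g'' ?q (0, d\<nu> ?\<kappa>' y b) (d\<mu> \<kappa> x a, 0))"
      unfolding g''_sym[OF r'(3), of _ "(d\<mu> \<kappa> x a, 0)"] by (rule bounded_linear_g''(2)[OF r'(3) bl])
    then show ?thesis unfolding M_def by (simp add: bounded_linear_Blinfun_apply)
  qed
  have component: "(((\<lambda>x. Dy \<Y> c x y b) \<circ> inv_into (fst \<kappa>) (snd \<kappa>)) has_derivative (\<lambda>a. M a b))
      (at (snd \<kappa> x))" for b
    unfolding M
    by (rule has_derivative_in_embedded_chart[OF manifolds(1) embedded(1) ambient(1) \<kappa>(1) charts(1) \<kappa>(2) r'(1)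
          has_derivative_slices(1)[OF g_deriv(2)[OF r'(3)]] open_slices(1)[of "snd \<nu> y"]])
      (use r' y in \<open>simp_all add: Dy_rep(2) rep_at_def\<close>)
  then have "(((\<lambda>x. Dy \<Y> c x y) \<circ> inv_into (fst \<kappa>) (snd \<kappa>)) has_derivative M) (at (snd \<kappa> x))"
    by (intro has_derivative_covectorI) (simp add: o_def)
  then show thesis using M that by blast
qed

text \<open>The formula of \<open>Dx_rep\<close> holds at all nearby points of
  \<open>closure Y\<close>, and \<open>g' _ v\<close> is continuous because it is
  differentiable.\<close>

lemma Dx_tendsto_rep:
  assumes x: "x \<in> X" and y: "y \<in> closure Y" and r: "rep_at x y"
  shows "(Dx \<X> c x \<longlongrightarrow> Dx \<X> c x y) (at y within closure Y)"
proof (rule tendsto_covectorI)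
  fix a
  let ?q = "\<lambda>y. (snd \<mu> x, snd \<nu> y)" and ?v = "(d\<mu> (chart_at \<X> x) x a, 0)"
  have r': "x \<in> fst \<mu>" "y \<in> fst \<nu>" "?q y \<in> W" using r by (auto simp: rep_at_def)
  note \<nu> = smooth_manifold_chartD[OF ambient(2) charts(2)]
  have "open (fst \<nu>)" using \<nu>(1) by simp
  have "continuous_on (fst \<nu>) (snd \<nu>)" using \<nu>(3) by (simp add: homeomorphism_def)
  then have "isCont (snd \<nu>) y" using \<open>open (fst \<nu>)\<close> r'(2) by (simp add: continuous_on_eq_continuous_at)
  then have "(snd \<nu> \<longlongrightarrow> snd \<nu> y) (at y within closure Y)"
    using continuous_at_imp_continuous_at_within continuous_within by blast
  then have q: "(?q \<longlongrightarrow> ?q y) (at y within closure Y)" by (intro tendsto_intros)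
  have "isCont (\<lambda>q. g' q ?v) (?q y)"
    using has_derivative_continuous[OF g_deriv(2)[OF r'(3)]] .
  then have lim: "((\<lambda>y. g' (?q y) ?v) \<longlongrightarrow> g' (?q y) ?v) (at y within closure Y)"
    using q by (rule isCont_tendsto_compose)
  have 1: "\<forall>\<^sub>F y' in at y within closure Y. y' \<in> fst \<nu> \<and> y' \<in> closure Y"
    unfolding eventually_at_topological using \<open>open (fst \<nu>)\<close> r'(2) by blast
  have 2: "\<forall>\<^sub>F y' in at y within closure Y. ?q y' \<in> W"
    using q open_W r'(3) by (rule topological_tendstoD)
  have "\<forall>\<^sub>F y' in at y within closure Y. g' (?q y') ?v = Dx \<X> c x y' a"
    using 1 2
  proof eventually_elim
    case (elim y')
    then show ?case using Dx_rep(2)[OF x, of y' a] r'(1) by (simp add: rep_at_def)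
  qed
  then show "((\<lambda>y'. Dx \<X> c x y' a) \<longlongrightarrow> Dx \<X> c x y a) (at y within closure Y)"
    using lim unfolding Dx_rep(2)[OF x y r] by (rule Lim_transform_eventually[rotated])
qed

end

section \<open>Differentials of the cost without reference to a local representative\<close>

context smooth_cost
begin

lemma rep_exists:
  assumes x: "x \<in> X" and y: "y \<in> closure Y"
  obtains \<mu> \<nu> W g where "smooth_cost_rep \<M> \<N> \<X> X \<Y> Y c \<mu> \<nu> W g" "smooth_cost_rep.rep_at \<mu> \<nu> W x y"
proof -
  obtain \<mu> \<nu> W g where *: "\<mu> \<in> \<M>" "\<nu> \<in> \<N>" "x \<in> fst \<mu>" "y \<in> fst \<nu>" "open W" "(snd \<mu> x, snd \<nu> y) \<in> W"
    "Ck_on 2 W g" "\<forall>x\<in>closure X \<inter> fst \<mu>. \<forall>y\<in>closure Y \<inter> fst \<nu>. (snd \<mu> x, snd \<nu> y) \<in> W \<longrightarrow>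
      c x y = g (snd \<mu> x, snd \<nu> y)"
    using C2[unfolded Ck_on_product_def, rule_format, OF closure_subset[THEN subsetD, OF x] y] by (fastforce simp del: Ck_on.simps)
  then interpret smooth_cost_rep \<M> \<N> \<X> X \<Y> Y c \<mu> \<nu> W g
    by unfold_locales auto
  show thesis
    using that smooth_cost_rep_axioms * by (auto simp: rep_at_def)
qed

lemma Dx_differential:
  assumes "x \<in> X" "y \<in> closure Y"
  shows "has_differential \<X> (\<lambda>x. c x y) x (Dx \<X> c x y)"
proof -
  obtain \<mu> \<nu> W g where "smooth_cost_rep \<M> \<N> \<X> X \<Y> Y c \<mu> \<nu> W g" "smooth_cost_rep.rep_at \<mu> \<nu> W x y"
    using assms by (rule rep_exists)
  then show ?thesis using assms by (intro smooth_cost_rep.Dx_rep(1))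
qed

lemma continuous_on_Dx:
  assumes "x \<in> X"
  shows "continuous_on (closure Y) (Dx \<X> c x)"
  unfolding continuous_on_def
proof
  fix y assume y: "y \<in> closure Y"
  then obtain \<mu> \<nu> W g where "smooth_cost_rep \<M> \<N> \<X> X \<Y> Y c \<mu> \<nu> W g" "smooth_cost_rep.rep_at \<mu> \<nu> W x y"
    using rep_exists[OF assms y] by blast
  then show "(Dx \<X> c x \<longlongrightarrow> Dx \<X> c x y) (at y within closure Y)"
    using assms y by (intro smooth_cost_rep.Dx_tendsto_rep)
qed

lemma Dy_differential:
  assumes "x \<in> X" "y \<in> Y"
  shows "has_differential \<Y> (c x) y (Dy \<Y> c x y)"
proof -
  obtain \<mu> \<nu> W g where "smooth_cost_rep \<M> \<N> \<X> X \<Y> Y c \<mu> \<nu> W g" "smooth_cost_rep.rep_at \<mu> \<nu> W x y"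
    using rep_exists[OF assms(1) closure_subset[THEN subsetD, OF assms(2)]] by blast
  then show ?thesis using assms by (intro smooth_cost_rep.Dy_rep(1))
qed

lemma Dxy_differential:
  assumes "x \<in> X" "y \<in> Y"
  shows "has_differential \<Y> (Dx \<X> c x) y (Dxy \<X> \<Y> c x y)"
proof -
  obtain \<mu> \<nu> W g where "smooth_cost_rep \<M> \<N> \<X> X \<Y> Y c \<mu> \<nu> W g" "smooth_cost_rep.rep_at \<mu> \<nu> W x y"
    using rep_exists[OF assms(1) closure_subset[THEN subsetD, OF assms(2)]] by blast
  then show ?thesis using assms by (intro smooth_cost_rep.Dxy_rep(1))
qed

text \<open>Both mixed derivatives are values of the symmetric \<open>g''\<close>. At
  \<open>y\<^sub>0\<close> this turns non-degeneracy of \<open>c\<close> into the submersion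
  property of the quotient map.\<close>

lemma Dy_differential_transpose:
  assumes x: "x \<in> X" and y: "y \<in> Y"
  obtains M where "has_differential \<X> (\<lambda>x. Dy \<Y> c x y) x M"
    and "\<And>a b. M a b = Dxy \<X> \<Y> c x y b a"
proof -
  obtain \<mu> \<nu> W g where *: "smooth_cost_rep \<M> \<N> \<X> X \<Y> Y c \<mu> \<nu> W g" "smooth_cost_rep.rep_at \<mu> \<nu> W x y"
    using rep_exists[OF assms(1) closure_subset[THEN subsetD, OF assms(2)]] by blast
  then interpret smooth_cost_rep \<M> \<N> \<X> X \<Y> Y c \<mu> \<nu> W g by blast
  obtain M where M: "(((\<lambda>x. Dy \<Y> c x y) \<circ> inv_into (fst (chart_at \<X> x)) (snd (chart_at \<X> x)))
      has_derivative M) (at (snd (chart_at \<X> x) x))"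
    "\<And>a b. M a b = g'' (snd \<mu> x, snd \<nu> y) (0, d\<nu> (chart_at \<Y> y) y b) (d\<mu> (chart_at \<X> x) x a, 0)"
    using Dyx_rep[OF chart_at_mem[OF manifolds(1) x] y *(2)] by blast
  have "Blinfun M a b = Dxy \<X> \<Y> c x y b a" for a b
    using *(2) unfolding bounded_linear_Blinfun_apply[OF has_derivative_bounded_linear[OF M(1)]]
      M(2) Dxy_rep(2)[OF x y *(2)] by (intro g''_sym) (simp add: rep_at_def)
  then show thesis using that[OF has_differential_BlinfunI[OF M(1)]] by blast
qed

text \<open>Supplies the continuity on a whole neighbourhood that
  \<open>has_derivative_factor_submersion\<close> asks of the quotient map.\<close>

lemma continuous_on_Dy_in_chart:
  assumes \<kappa>: "\<kappa> \<in> \<X>" and y: "y \<in> Y"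
  shows "continuous_on (snd \<kappa> ` fst \<kappa>) ((\<lambda>x. Dy \<Y> c x y) \<circ> inv_into (fst \<kappa>) (snd \<kappa>))"
proof (rule continuous_at_imp_continuous_on, safe)
  fix x assume x: "x \<in> fst \<kappa>"
  then have "x \<in> X" using smooth_manifold_chartD(5)[OF manifolds(1) \<kappa>] by blast
  then obtain \<mu> \<nu> W g where *: "smooth_cost_rep \<M> \<N> \<X> X \<Y> Y c \<mu> \<nu> W g" "smooth_cost_rep.rep_at \<mu> \<nu> W x y"
    using rep_exists[OF _ closure_subset[THEN subsetD, OF y]] by blast
  then interpret smooth_cost_rep \<M> \<N> \<X> X \<Y> Y c \<mu> \<nu> W g by blast
  show "isCont ((\<lambda>x. Dy \<Y> c x y) \<circ> inv_into (fst \<kappa>) (snd \<kappa>)) (snd \<kappa> x)"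
    using Dyx_rep[OF \<kappa> x y *(2)] by (metis has_derivative_continuous)
qed

end

section \<open>The reduced cost\<close>

locale reduced_cost = smooth_cost \<M> \<N> \<X> X \<Y> Y c
  for \<M> :: "('a::{t2_space, second_countable_topology}, 'p::euclidean_space) chart set"
    and \<N> :: "('b::{t2_space, second_countable_topology}, 'q::euclidean_space) chart set"
    and \<X> :: "('a, 'e::euclidean_space) chart set" and X :: "'a set"
    and \<Y> :: "('b, 'f::euclidean_space) chart set" and Y :: "'b set"
    and c :: "'a \<Rightarrow> 'b \<Rightarrow> real" +
  fixes y\<^sub>0 :: 'b and b :: "'a set \<Rightarrow> 'b \<Rightarrow> real"
  assumes connected_Y: "connected Y"
    and nondeg: "nondegenerate \<X> X \<Y> Y c"
    and level_independent:
      "\<And>x y y'. x \<in> X \<Longrightarrow> y \<in> Y \<Longrightarrow> y' \<in> Y \<Longrightarrow> level_set X \<Y> c x y = level_set X \<Y> c x y'"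
    and y0: "y\<^sub>0 \<in> Y"
    and b: "is_reduced_cost (quotient_space X \<Y> c y\<^sub>0) \<Y> Y c y\<^sub>0 b"
begin

abbreviation "Z \<equiv> quotient_space X \<Y> c y\<^sub>0"
abbreviation "\<Z> \<equiv> quotient_atlas X \<Y> c y\<^sub>0"
abbreviation "F x \<equiv> Dy \<Y> c x y\<^sub>0"
abbreviation "cls x \<equiv> level_set X \<Y> c x y\<^sub>0"
abbreviation "coord z \<equiv> the_elem (F ` z)"

section \<open>The quotient and its global chart\<close>

lemma Z_eq: "Z = cls ` X"
  by (auto simp: quotient_space_def quotient_def)

lemma mem_cls: "x \<in> X \<Longrightarrow> x \<in> cls x"
  by (simp add: level_set_def)

lemma coord_cls: "x \<in> X \<Longrightarrow> coord (cls x) = F x"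
proof -
  assume "x \<in> X"
  then have "F ` cls x = {F x}" by (auto simp: level_set_def)
  then show ?thesis by simp
qed

lemma inv_coord: "x \<in> X \<Longrightarrow> inv_into Z coord (F x) = cls x"
proof (rule inv_into_f_eq)
  have eq: "cls x = cls x'" if "F x = F x'" for x x'
    using that by (simp add: level_set_def)
  show "inj_on coord Z"
  proof (rule inj_onI)
    fix z z' assume "z \<in> Z" "z' \<in> Z" "coord z = coord z'"
    then obtain x x' where "x \<in> X" "x' \<in> X" and "z = cls x" "z' = cls x'" unfolding Z_eq by blast
    have "F x = F x'"
      using \<open>coord z = coord z'\<close> coord_cls[OF \<open>x \<in> X\<close>] coord_cls[OF \<open>x' \<in> X\<close>] \<open>z = cls x\<close> \<open>z' = cls x'\<close>
      by simp
    from eq[OF this] show "z = z'" using \<open>z = cls x\<close> \<open>z' = cls x'\<close> by simp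
  qed
qed (simp_all add: Z_eq coord_cls)

lemma b_differential:
  "z \<in> Z \<Longrightarrow> x \<in> z \<Longrightarrow> y \<in> Y \<Longrightarrow> has_differential \<Y> (b z) y (Dy \<Y> c x y)"
  using b by (simp add: is_reduced_cost_def)

lemma chart_at_Z: "z \<in> Z \<Longrightarrow> chart_at \<Z> z = (Z, coord)"
  unfolding chart_at_def quotient_atlas_def by (rule some_equality) auto

text \<open>As \<open>x\<close> lies in its own class, \<open>b (cls x)\<close> and
  \<open>c x\<close> have the same differential on the connected \<open>Y\<close>; the constant
  difference is read off at \<open>y\<^sub>0\<close>, where \<open>b\<close> is 0.\<close>

lemma b_eq:
  assumes x: "x \<in> X" and y: "y \<in> Y"
  shows "b (cls x) y = c x y - c x y\<^sub>0"
proof -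
  have "(\<lambda>y. b (cls x) y - c x y) constant_on Y"
  proof (rule constant_on_if_zero_differential[OF manifolds(2) connected_Y])
    fix y assume y: "y \<in> Y"
    have "has_differential \<Y> (b (cls x)) y (Dy \<Y> c x y)"
      by (rule b_differential) (simp_all add: Z_eq x y mem_cls)
    from has_differential_diff[OF this Dy_differential[OF x y]]
    show "has_differential \<Y> (\<lambda>y. b (cls x) y - c x y) y 0" by simp
  qed
  then have "b (cls x) y - c x y = b (cls x) y\<^sub>0 - c x y\<^sub>0"
    using y y0 unfolding constant_on_def by auto
  moreover have "b (cls x) y\<^sub>0 = 0"
    using b x by (simp add: is_reduced_cost_def Z_eq)
  ultimately show ?thesis by simp
qed

section \<open>The differential of the reduced cost\<close>

text \<open>\<open>T\<close> is the differential of the quotient map at \<open>x\<close> and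
  \<open>R\<close> a right inverse. Both are chosen before \<open>y\<close>, so the relations
  between the covectors of \<open>b\<close> and \<open>c\<close> are affine with coefficients
  independent of \<open>y\<close>. The second equation is the chain rule for \<open>b\<close> after
  the quotient map.\<close>

lemma Dx_reduced_exists:
  assumes x: "x \<in> X"
  obtains R :: "('f \<Rightarrow>\<^sub>L real) \<Rightarrow>\<^sub>L 'e" and T :: "'e \<Rightarrow>\<^sub>L ('f \<Rightarrow>\<^sub>L real)"
  where "\<And>y. y \<in> Y \<Longrightarrow> Dx \<Z> b (cls x) y = (Dx \<X> c x y - Dx \<X> c x y\<^sub>0) o\<^sub>L R"
    and "\<And>y. y \<in> Y \<Longrightarrow>
      ((Dx \<X> c x y - Dx \<X> c x y\<^sub>0) o\<^sub>L R) o\<^sub>L T = Dx \<X> c x y - Dx \<X> c x y\<^sub>0"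
proof -
  obtain T where T: "has_differential \<X> F x T" "\<And>a b. T a b = Dxy \<X> \<Y> c x y\<^sub>0 b a"
    using Dy_differential_transpose[OF x y0] by blast
  have "inj (blinfun_apply (Dxy \<X> \<Y> c x y\<^sub>0))" using nondeg x y0 by (simp add: nondegenerate_def)
  from surj_if_transpose_inj[OF T(2) this] obtain S where S: "linear S" "\<And>w. covector_repr (T (S w)) = w"
    by blast
  define R where "R = Blinfun (\<lambda>p. S (covector_repr p))"
  have "bounded_linear (\<lambda>p. S (covector_repr p))"
    using S(1)[unfolded linear_conv_bounded_linear] bounded_linear_covector_repr
    by (rule bounded_linear_compose)
  then have R: "R p = S (covector_repr p)" for p
    unfolding R_def by (simp add: bounded_linear_Blinfun_apply)
  let ?U = "fst (chart_at \<X> x)" and ?\<phi> = "snd (chart_at \<X> x)"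
  let ?inv = "inv_into ?U ?\<phi>"
  note \<kappa> = chart_at_mem[OF manifolds(1) x]
  note \<kappa>D = smooth_manifold_chartD[OF manifolds(1) \<kappa>(1)]
  have inv: "?inv (?\<phi> x) = x" using \<kappa>(2) \<kappa>D(4) by simp
  have invX: "?inv u \<in> X" if "u \<in> ?\<phi> ` ?U" for u
    using that inv_into_into \<kappa>D(5) by (metis subsetD)
  have F: "((\<lambda>u. covector_repr (F (?inv u))) has_derivative (\<lambda>a. covector_repr (T a))) (at (?\<phi> x))"
    using T(1) unfolding has_differential_alt o_def
    by (rule bounded_linear.has_derivative[OF bounded_linear_covector_repr])
  have contF: "continuous_on (?\<phi> ` ?U) (\<lambda>u. covector_repr (F (?inv u)))"
    using continuous_on_Dy_in_chart[OF \<kappa>(1) y0] unfolding o_def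
    by (rule bounded_linear.continuous_on[OF bounded_linear_covector_repr])
  have main: "has_differential \<Z> (\<lambda>z. b z y) (cls x) ((Dx \<X> c x y - Dx \<X> c x y\<^sub>0) o\<^sub>L R)
      \<and> ((Dx \<X> c x y - Dx \<X> c x y\<^sub>0) o\<^sub>L R) o\<^sub>L T = Dx \<X> c x y - Dx \<X> c x y\<^sub>0"
    if y: "y \<in> Y" for y
  proof
    let ?L = "Dx \<X> c x y - Dx \<X> c x y\<^sub>0"
    let ?b = "\<lambda>p. b (inv_into Z coord p) y"
    let ?h = "\<lambda>u. c (?inv u) y - c (?inv u) y\<^sub>0"
    have h: "(?h has_derivative blinfun_apply ?L) (at (?\<phi> x))"
      using has_differential_diff[OF Dx_differential[OF x closure_subset[THEN subsetD, OF y]]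
          Dx_differential[OF x closure_subset[THEN subsetD, OF y0]]]
      unfolding has_differential_alt o_def .
    have bF: "?b (F (?inv u)) = ?h u" if "u \<in> ?\<phi> ` ?U" for u
      using invX[OF that] y by (simp add: inv_coord b_eq)
    \<comment> \<open>The submersion lemma is applied in Riesz coordinates; composing with
      \<open>covector_repr\<close> afterwards returns to covectors.\<close>
    have "((\<lambda>w. ?b (blinfun_inner_left w)) has_derivative (\<lambda>w. ?L (S w)))
        (at (covector_repr (F (?inv (?\<phi> x)))))"
      by (rule has_derivative_factor_submersion[OF \<kappa>D(2) _ contF F S h])
        (use \<kappa>(2) bF in simp_all)
    then have "((\<lambda>p. ?b (blinfun_inner_left (covector_repr p))) has_derivative
        (\<lambda>p. ?L (S (covector_repr p)))) (at (F x))"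
      unfolding inv
      by (rule has_derivative_compose[OF bounded_linear_imp_has_derivative[OF bounded_linear_covector_repr]])
    moreover have "(\<lambda>p. ?L (S (covector_repr p))) = blinfun_apply (?L o\<^sub>L R)"
      by (rule ext) (simp only: blinfun_apply_blinfun_compose R)
    ultimately have b': "(?b has_derivative blinfun_apply (?L o\<^sub>L R)) (at (F x))"
      by simp
    then show "has_differential \<Z> (\<lambda>z. b z y) (cls x) (?L o\<^sub>L R)"
      using x by (simp add: has_differential_def chart_at_Z Z_eq coord_cls o_def)
    \<comment> \<open>Now that \<open>?b\<close> is known to be differentiable, \<open>?h\<close>
      can be differentiated as a composition; uniqueness of derivatives then yields the second
      equation.\<close>
    have "((\<lambda>u. ?b (F (?inv u))) has_derivative (\<lambda>a. (?L o\<^sub>L R) (T a))) (at (?\<phi> x))"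
      by (rule has_derivative_compose[OF T(1)[unfolded has_differential_alt o_def]]) (simp only: inv b')
    then have "(?h has_derivative (\<lambda>a. (?L o\<^sub>L R) (T a))) (at (?\<phi> x))"
      by (rule has_derivative_transform_within_open[OF _ \<kappa>D(2)]) (use \<kappa>(2) bF in simp_all)
    then have "(\<lambda>a. (?L o\<^sub>L R) (T a)) = blinfun_apply ?L" using h by (rule has_derivative_unique)
    from fun_cong[OF this] show "(?L o\<^sub>L R) o\<^sub>L T = ?L" by (intro blinfun_eqI) simp
  qed
  show thesis
  proof (rule that)
    fix y assume y: "y \<in> Y"
    show "Dx \<Z> b (cls x) y = (Dx \<X> c x y - Dx \<X> c x y\<^sub>0) o\<^sub>L R"
      unfolding Dx_def[of \<Z>] by (rule differential_eq[OF conjunct1[OF main[OF y]]])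
    show "((Dx \<X> c x y - Dx \<X> c x y\<^sub>0) o\<^sub>L R) o\<^sub>L T = Dx \<X> c x y - Dx \<X> c x y\<^sub>0"
      using main[OF y] by (rule conjunct2)
  qed
qed

section \<open>Transfer of the conditions from \<open>c\<close> to \<open>b\<close>\<close>

text \<open>Equal covectors at \<open>y\<close> mean equal level sets at \<open>y\<close>; by
  independence of \<open>y\<close> these are the level sets at \<open>y\<^sub>0\<close>, that is,
  the classes themselves.\<close>

lemma inj_reduced_Dy:
  assumes y: "y \<in> Y"
  shows "inj_on (\<lambda>z. Dy \<Y> b z y) Z"
proof (rule inj_onI)
  fix z z' assume z: "z \<in> Z" "z' \<in> Z" and eq: "Dy \<Y> b z y = Dy \<Y> b z' y"
  obtain x x' where x: "x \<in> X" "x' \<in> X" "z = cls x" "z' = cls x'" using z by (auto simp: Z_eq)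
  have "Dy \<Y> b (cls x) y = Dy \<Y> c x y" if "x \<in> X" for x
    unfolding Dy_def[of \<Y> b]
    by (rule differential_eq, rule b_differential) (simp_all add: Z_eq y that mem_cls)
  then have "level_set X \<Y> c x y = level_set X \<Y> c x' y"
    using eq x by (simp add: level_set_def)
  then show "z = z'" using level_independent[OF _ y y0] x by blast
qed

text \<open>The formula \<open>L y o\<^sub>L R\<close> also describes the continuous extension, and
  composing with \<open>T\<close> recovers \<open>L y\<close> on the whole closure, where
  \<open>L\<close> is injective by the twist of \<open>c\<close>.\<close>

lemma twisted_reduced:
  assumes tw: "twisted X Y (Dx \<X> c)"
  shows "twisted Z Y (\<lambda>z. continuous_extension Y (Dx \<Z> b z))"
  unfolding twisted_def
proof
  fix z assume "z \<in> Z"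
  then obtain x where x: "x \<in> X" "z = cls x" by (auto simp: Z_eq)
  define L where "L y = Dx \<X> c x y - Dx \<X> c x y\<^sub>0" for y
  obtain R T where R: "\<And>y. y \<in> Y \<Longrightarrow> Dx \<Z> b z y = L y o\<^sub>L R"
    and T: "\<And>y. y \<in> Y \<Longrightarrow> (L y o\<^sub>L R) o\<^sub>L T = L y"
    using Dx_reduced_exists[OF x(1)] unfolding L_def x(2) by blast
  have L: "continuous_on (closure Y) L"
    unfolding L_def by (intro continuous_intros continuous_on_Dx x)
  \<comment> \<open>A continuous function that vanishes on \<open>Y\<close> vanishes on its
    closure.\<close>
  have T': "(L y o\<^sub>L R) o\<^sub>L T = L y" if "y \<in> closure Y" for y
  proof -
    have "continuous_on (closure Y) (\<lambda>y. ((L y o\<^sub>L R) o\<^sub>L T) - L y)"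
      by (intro continuous_intros L)
    then have "((L y o\<^sub>L R) o\<^sub>L T) - L y = 0"
      by (rule continuous_constant_on_closure) (simp_all add: T that)
    then show ?thesis by simp
  qed
  have ext: "continuous_extension Y (Dx \<Z> b z) y = L y o\<^sub>L R" if y: "y \<in> closure Y" for y
  proof (cases "y \<in> Y")
    case True
    then show ?thesis using R by (simp add: continuous_extension_def)
  next
    case False
    \<comment> \<open>A point of the closure outside \<open>Y\<close> is a limit point of
      \<open>Y\<close>, so the \<open>Lim\<close> in the extension is determined by
      convergence.\<close>
    then have "at y within Y \<noteq> bot"
      using y by (simp add: closure_def trivial_limit_within)
    moreover have "((\<lambda>y. L y o\<^sub>L R) \<longlongrightarrow> (L y o\<^sub>L R)) (at y within Y)"
    proof -
      have "continuous_on (closure Y) (\<lambda>y. L y o\<^sub>L R)" by (intro continuous_intros L)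
      then have "((\<lambda>y. L y o\<^sub>L R) \<longlongrightarrow> (L y o\<^sub>L R)) (at y within closure Y)"
        using y by (simp add: continuous_on_def)
      then show ?thesis using closure_subset by (rule tendsto_within_subset)
    qed
    then have "(Dx \<Z> b z \<longlongrightarrow> (L y o\<^sub>L R)) (at y within Y)"
      by (rule Lim_transform_eventually) (simp add: eventually_at_filter R)
    ultimately show ?thesis using False by (simp add: continuous_extension_def tendsto_Lim)
  qed
  show "inj_on (continuous_extension Y (Dx \<Z> b z)) (closure Y)"
  proof (rule inj_onI)
    fix y y' assume y: "y \<in> closure Y" "y' \<in> closure Y"
      and eq: "continuous_extension Y (Dx \<Z> b z) y = continuous_extension Y (Dx \<Z> b z) y'"
    have "L y o\<^sub>L R = L y' o\<^sub>L R" using eq by (simp only: ext y)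
    then have "L y = L y'" using T'[OF y(1)] T'[OF y(2)] by metis
    then show "y = y'" using tw x y by (simp add: L_def twisted_def inj_on_def)
  qed
qed

text \<open>Both relations of \<open>Dx_reduced_exists\<close> are differentiated in
  \<open>y\<close>: the derivative for \<open>b\<close> is that for \<open>c\<close> followed by
  \<open>R\<close>, and composing with \<open>T\<close> gives back the derivative for
  \<open>c\<close>, so injectivity passes to \<open>b\<close>.\<close>

lemma nondegenerate_reduced: "nondegenerate \<Z> Z \<Y> Y b"
  unfolding nondegenerate_def
proof (intro ballI)
  fix z y assume "z \<in> Z" and y: "y \<in> Y"
  then obtain x where x: "x \<in> X" "z = cls x" by (auto simp: Z_eq)
  obtain R T where R: "\<And>y. y \<in> Y \<Longrightarrow> Dx \<Z> b z y = (Dx \<X> c x y - Dx \<X> c x y\<^sub>0) o\<^sub>L R"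
    and T: "\<And>y. y \<in> Y \<Longrightarrow>
      ((Dx \<X> c x y - Dx \<X> c x y\<^sub>0) o\<^sub>L R) o\<^sub>L T = Dx \<X> c x y - Dx \<X> c x y\<^sub>0"
    using Dx_reduced_exists[OF x(1)] unfolding x(2) by blast
  let ?D = "Dxy \<X> \<Y> c x y"
  have l: "bounded_linear (\<lambda>M. M o\<^sub>L R)" "bounded_linear (\<lambda>M. (M o\<^sub>L R) o\<^sub>L T)"
    by (intro bounded_linear_intros)+
  have "has_differential \<Y> (Dx \<Z> b z) y (Blinfun (\<lambda>h. ?D h o\<^sub>L R))"
  proof (rule has_differential_linear_image[OF manifolds(2) y Dxy_differential[OF x(1) y] l(1),
        where k="Dx \<X> c x y\<^sub>0 o\<^sub>L R"])
    fix y assume "y \<in> Y"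
    from R[OF this] show "Dx \<Z> b z y = (Dx \<X> c x y o\<^sub>L R) - (Dx \<X> c x y\<^sub>0 o\<^sub>L R)"
      by (simp add: bounded_bilinear.diff_left[OF bounded_bilinear_blinfun_compose])
  qed
  then have "Dxy \<Z> \<Y> b z y = Blinfun (\<lambda>h. ?D h o\<^sub>L R)"
    unfolding Dxy_def[of \<Z>] by (rule differential_eq)
  then have Db: "Dxy \<Z> \<Y> b z y h = ?D h o\<^sub>L R" for h
    using bounded_linear_compose[OF l(1) blinfun.bounded_linear_right, of ?D]
    by (simp add: bounded_linear_Blinfun_apply)
  have "has_differential \<Y> (Dx \<X> c x) y (Blinfun (\<lambda>h. (?D h o\<^sub>L R) o\<^sub>L T))"
  proof (rule has_differential_linear_image[OF manifolds(2) y Dxy_differential[OF x(1) y] l(2),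
        \<comment> \<open>The terms at \<open>y\<^sub>0\<close> do not vary with \<open>y\<close>
          and are collected in \<open>k\<close>, which disappears on differentiation.\<close>
        where k="((Dx \<X> c x y\<^sub>0 o\<^sub>L R) o\<^sub>L T) - Dx \<X> c x y\<^sub>0"])
    fix y assume "y \<in> Y"
    from T[OF this] show "Dx \<X> c x y = ((Dx \<X> c x y o\<^sub>L R) o\<^sub>L T) -
        (((Dx \<X> c x y\<^sub>0 o\<^sub>L R) o\<^sub>L T) - Dx \<X> c x y\<^sub>0)"
      by (simp add: bounded_bilinear.diff_left[OF bounded_bilinear_blinfun_compose] algebra_simps)
  qed
  then have "?D = Blinfun (\<lambda>h. (?D h o\<^sub>L R) o\<^sub>L T)"
    by (rule has_differential_unique[OF Dxy_differential[OF x(1) y]])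
  then have Dc: "?D h = (?D h o\<^sub>L R) o\<^sub>L T" for h
    using bounded_linear_compose[OF l(2) blinfun.bounded_linear_right, of ?D]
    by (metis bounded_linear_Blinfun_apply)
  have "inj (blinfun_apply ?D)" using nondeg x y by (simp add: nondegenerate_def)
  then show "inj (blinfun_apply (Dxy \<Z> \<Y> b z y))"
    unfolding inj_def Db by (metis Dc)
qed

text \<open>Translations and linear maps preserve convexity, and \<open>R\<close> is the same for
  all \<open>y\<close>.\<close>

lemma cost_convex_reduced:
  assumes "cost_convex \<X> X Y c"
  shows "cost_convex \<Z> Z Y b"
  unfolding cost_convex_def
proof
  fix z assume "z \<in> Z"
  then obtain x where x: "x \<in> X" "z = cls x" by (auto simp: Z_eq)
  obtain R where R: "\<And>y. y \<in> Y \<Longrightarrow> Dx \<Z> b z y = (Dx \<X> c x y - Dx \<X> c x y\<^sub>0) o\<^sub>L R"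
    using Dx_reduced_exists[OF x(1)] unfolding x(2) by metis
  have "Dx \<Z> b z ` Y = (\<lambda>M. M o\<^sub>L R) ` (\<lambda>M. M - Dx \<X> c x y\<^sub>0) ` Dx \<X> c x ` Y"
    by (simp add: image_image R)
  moreover have "linear (\<lambda>M :: 'e \<Rightarrow>\<^sub>L real. M o\<^sub>L R)"
    by (intro bounded_linear.linear bounded_linear_intros)
  ultimately show "convex (Dx \<Z> b z ` Y)"
    using assms x(1) by (simp add: cost_convex_def convex_linear_image)
qed

end

theorem theorem3p7:
  fixes \<M> :: "('a::{t2_space, second_countable_topology}, 'p::euclidean_space) chart set"
    and \<N> :: "('b::{t2_space, second_countable_topology}, 'q::euclidean_space) chart set"
    and \<X> :: "('a, 'e::euclidean_space) chart set" and X :: "'a set"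
    and \<Y> :: "('b, 'f::euclidean_space) chart set" and Y :: "'b set"
    and c :: "'a \<Rightarrow> 'b \<Rightarrow> real" and y\<^sub>0 :: 'b
    and Z :: "'a set set" and \<Z> :: "('a set, 'f \<Rightarrow>\<^sub>L real) chart set"
    and b :: "'a set \<Rightarrow> 'b \<Rightarrow> real"
  assumes dim: "DIM('f) \<le> DIM('e)"
    and ambient: "smooth_manifold UNIV \<M>" "smooth_manifold UNIV \<N>"
    and manifolds: "smooth_manifold X \<X>" "smooth_manifold Y \<Y>"
    and embedded: "smoothly_embedded X \<X> UNIV \<M>" "smoothly_embedded Y \<Y> UNIV \<N>"
    and compact_closures: "compact (closure X)" "compact (closure Y)"
    and connected_Y: "connected Y"
    and c_C4: "Ck_on_product 4 \<M> (closure X) \<N> (closure Y) c"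
    and c_nondegenerate: "nondegenerate \<X> X \<Y> Y c"
    and level_connected: "\<And>x y. x \<in> X \<Longrightarrow> y \<in> Y \<Longrightarrow> connected (level_set X \<Y> c x y)"
    and level_independent:
      "\<And>x y y'. x \<in> X \<Longrightarrow> y \<in> Y \<Longrightarrow> y' \<in> Y \<Longrightarrow> level_set X \<Y> c x y = level_set X \<Y> c x y'"
    and y0: "y\<^sub>0 \<in> Y"
    and Z: "Z = quotient_space X \<Y> c y\<^sub>0" "\<Z> = quotient_atlas X \<Y> c y\<^sub>0"
    and b: "is_reduced_cost Z \<Y> Y c y\<^sub>0 b"
  shows "(twisted X Y (Dx \<X> c) \<longrightarrow>
           twisted Z Y (\<lambda>z. continuous_extension Y (Dx \<Z> b z)) \<and>
           (\<forall>y\<in>Y. inj_on (\<lambda>z. Dy \<Y> b z y) Z)) \<and>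
         (nondegenerate \<X> X \<Y> Y c \<longrightarrow> nondegenerate \<Z> Z \<Y> Y b) \<and>
         (cost_convex \<X> X Y c \<longrightarrow> cost_convex \<Z> Z Y b)"
proof -
  have "Ck_on_product 2 \<M> (closure X) \<N> (closure Y) c"
    using c_C4 by (rule Ck_on_product_mono[rotated]) simp
  then interpret reduced_cost \<M> \<N> \<X> X \<Y> Y c y\<^sub>0 b
    using assms(2-17) b[unfolded Z(1)] by unfold_locales
  show ?thesis
    unfolding Z using inj_reduced_Dy twisted_reduced nondegenerate_reduced cost_convex_reduced by blast
qed

end
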